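(* Let $w\in S_n$ be fireworks. If $\alpha\in\mathrm{supp}(\mathfrak{G}_w)$ and $|\alpha|<\deg\mathfrak{G}_w$, then there exists $\beta\in\mathrm{supp}(\mathfrak{G}_w)$ with $\alpha<\beta$ in componentwise order.
   Context: Permutations act on the right; $s_j$ swaps positions $j,j+1$. With $\partial_j f=\frac{f-s_jf}{x_j-x_{j+1}}$ ($s_jf$ swaps $x_j,x_{j+1}$) and $\overline{\partial}_j f=\partial_j((1-x_{j+1})f)$, the Grothendieck polynomial is defined by $\mathfrak{G}_{w_0}=x_1^{n-1}\cdots x_{n-1}$ for $w_0=n(n-1)\cdots1$ and $\mathfrak{G}_w=\overline{\partial}_j\mathfrak{G}_{ws_j}$ when $w(j)<w(j+1)$. $\mathrm{supp}(f)$ is the set of exponent vectors of monomials of $f$ with nonzero coefficient; $|\alpha|=\alpha_1+\cdots+\alpha_n$. Componentwise order: $\alpha\le\beta$ iff $\alpha_i\le\beta_i$ for all $i$, and $\alpha<\beta$ means $\alpha\le\beta$, $\alpha\ne\beta$. A permutation is fireworks if the initial elements of its decreasing runs (maximal consecutive decreasing segments of the one-line notation) occur in increasing order. *)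

theory Defs
  imports "HOL-Library.Poly_Mapping" "HOL-Combinatorics.Permutations"
begin

text \<open>Monomials (exponent vectors) and integer polynomials in variables x_1, x_2, ...
  (variable x_i is index i; index 0 is unused).\<close>
type_synonym mono = "nat \<Rightarrow>\<^sub>0 nat"
type_synonym gpoly = "mono \<Rightarrow>\<^sub>0 int"

definition Xv :: "nat \<Rightarrow> gpoly" where
  "Xv i = Poly_Mapping.single (Poly_Mapping.single i 1) 1"

definition tr :: "nat \<Rightarrow> nat \<Rightarrow> nat" where
  "tr j i = (if i = j then Suc j else if i = Suc j then j else i)"

definition swap_mono :: "nat \<Rightarrow> mono \<Rightarrow> mono" where
  "swap_mono j a = Abs_poly_mapping (\<lambda>i. Poly_Mapping.lookup a (tr j i))"

definition swap_poly :: "nat \<Rightarrow> gpoly \<Rightarrow> gpoly" where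
  "swap_poly j f = Abs_poly_mapping (\<lambda>a. Poly_Mapping.lookup f (swap_mono j a))"

definition ddiff :: "nat \<Rightarrow> gpoly \<Rightarrow> gpoly" where
  "ddiff j f = (THE g. (Xv j - Xv (Suc j)) * g = f - swap_poly j f)"

definition dbar :: "nat \<Rightarrow> gpoly \<Rightarrow> gpoly" where
  "dbar j f = ddiff j ((1 - Xv (Suc j)) * f)"

text \<open>G_{w_0} = x_1^{n-1} x_2^{n-2} ... x_{n-1}\<close>
definition top_poly :: "nat \<Rightarrow> gpoly" where
  "top_poly n = (\<Prod>i\<in>{1..<n}. Xv i ^ (n - i))"

text \<open>number of non-inversions (= l(w_0) - l(w))\<close>
definition ninv :: "nat \<Rightarrow> (nat \<Rightarrow> nat) \<Rightarrow> nat" where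
  "ninv n w = card {(i, k). 1 \<le> i \<and> i < k \<and> k \<le> n \<and> w i < w k}"

text \<open>Recursive definition, choosing the least ascent j; w s_j = w o tr j
  (permutations act on the right, s_j swaps positions j, j+1).\<close>
primrec gro :: "nat \<Rightarrow> nat \<Rightarrow> (nat \<Rightarrow> nat) \<Rightarrow> gpoly" where
  "gro n 0 w = top_poly n"
| "gro n (Suc k) w =
     (if \<exists>j. 1 \<le> j \<and> j < n \<and> w j < w (Suc j)
      then (let j = (LEAST j. 1 \<le> j \<and> j < n \<and> w j < w (Suc j))
            in dbar j (gro n k (w \<circ> tr j)))
      else top_poly n)"

definition groth :: "nat \<Rightarrow> (nat \<Rightarrow> nat) \<Rightarrow> gpoly" where
  "groth n w = gro n (ninv n w) w"

definition supp :: "gpoly \<Rightarrow> mono set" where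
  "supp f = Poly_Mapping.keys f"

definition absv :: "mono \<Rightarrow> nat" where
  "absv a = (\<Sum>i\<in>Poly_Mapping.keys a. Poly_Mapping.lookup a i)"

definition tdeg :: "gpoly \<Rightarrow> nat" where
  "tdeg f = Max (absv ` supp f)"

definition comp_le :: "mono \<Rightarrow> mono \<Rightarrow> bool" where
  "comp_le a b \<longleftrightarrow> (\<forall>i. Poly_Mapping.lookup a i \<le> Poly_Mapping.lookup b i)"

definition comp_less :: "mono \<Rightarrow> mono \<Rightarrow> bool" where
  "comp_less a b \<longleftrightarrow> comp_le a b \<and> a \<noteq> b"

definition run_start :: "(nat \<Rightarrow> nat) \<Rightarrow> nat \<Rightarrow> bool" where
  "run_start w i \<longleftrightarrow> i = 1 \<or> w (i - 1) < w i"

definition fireworks :: "nat \<Rightarrow> (nat \<Rightarrow> nat) \<Rightarrow> bool" where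
  "fireworks n w \<longleftrightarrow> (\<forall>i k. 1 \<le> i \<and> i < k \<and> k \<le> n \<and> run_start w i \<and> run_start w k
      \<longrightarrow> w i < w k)"

end

theory Submission
  imports Defs
begin

text \<open>
  Write the Grothendieck polynomials as the coefficients of the Fomin--Kirillov product
  \<open>A\<^sub>1(x\<^sub>1) A\<^sub>2(x\<^sub>2) \<dots> A\<^sub>n\<^sub>-\<^sub>1(x\<^sub>n\<^sub>-\<^sub>1)\<close> in the 0-Hecke algebra, where
  \<open>A\<^sub>i(x) = (1 + x u\<^sub>n\<^sub>-\<^sub>1) \<dots> (1 + x u\<^sub>i)\<close> and \<open>u\<^sub>a\<^sup>2 = - u\<^sub>a\<close>. The Yang--Baxter equation gives
  \<open>A\<^sub>i(x) A\<^sub>i(y) = A\<^sub>i(y) A\<^sub>i(x)\<close>, which is the divided difference recursion. The coefficients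
  alternate in sign with the degree, so nothing cancels and the support can be read off from the
  walks that unravel the product from the left. For a fireworks permutation the exponent of
  \<open>x\<^sub>r\<close> is at most \<open>n - r\<close> minus the number of run starts after position \<open>r\<close>, since positions of
  left-to-right maxima stay such along every walk, and an explicit greedy walk attains all these
  bounds at once. Hence the support has a componentwise greatest element.
\<close>

section \<open>The Fomin--Kirillov product\<close>

lemma tr_simps [simp]:
  "tr j j = Suc j" "tr j (Suc j) = j" "i \<noteq> j \<Longrightarrow> i \<noteq> Suc j \<Longrightarrow> tr j i = i"
  by (auto simp: tr_def)

lemma tr_tr [simp]: "tr j (tr j i) = i"
  by (auto simp: tr_def)

lemma comp_tr_tr [simp]: "\<sigma> \<circ> tr j \<circ> tr j = \<sigma>" "tr j \<circ> (tr j \<circ> \<tau>) = \<tau>" "tr j \<circ> tr j = id"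
  by (auto simp: fun_eq_iff)

lemma bij_tr [simp]: "bij (tr j)"
  by (rule involuntory_imp_bij) simp

lemma inv_tr [simp]: "inv (tr j) = tr j"
  by (rule inv_unique_comp) auto

text \<open>The action of \<open>s + x u\<^sub>a\<close> on coefficient functions. Throughout, \<open>\<sigma>\<close> is the inverse of the
  permutation indexing a coefficient, so that left multiplication becomes \<open>\<sigma> \<circ> tr a\<close>.\<close>
definition hop :: "nat \<Rightarrow> 'a \<Rightarrow> 'a \<Rightarrow> ((nat \<Rightarrow> nat) \<Rightarrow> 'a::comm_ring_1) \<Rightarrow> (nat \<Rightarrow> nat) \<Rightarrow> 'a" where
  "hop a s x \<phi> \<sigma> = s * \<phi> \<sigma> + (if \<sigma> (Suc a) < \<sigma> a then x * (\<phi> (\<sigma> \<circ> tr a) - \<phi> \<sigma>) else 0)"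

lemma hop_scale: "hop a s x (\<lambda>\<sigma>. c * \<phi> \<sigma>) = (\<lambda>\<sigma>. c * hop a s x \<phi> \<sigma>)"
  by (auto simp: hop_def fun_eq_iff algebra_simps)

text \<open>This is \<open>(s + x u)(s' + x' u)\<close> multiplied out with \<open>u^2 = -u\<close>,
  where \<open>u\<close> is the letter \<open>a\<close>.\<close>

lemma hop_hop: "hop a s x (hop a s' x' \<phi>) = hop a (s * s') (s * x' + x * s' - x * x') \<phi>"
  by (auto simp: hop_def fun_eq_iff algebra_simps)

lemma hop_commute_far:
  assumes "Suc a < b"
  shows "hop a s x (hop b s' x' \<phi>) = hop b s' x' (hop a s x \<phi>)"
proof -
  have c: "\<sigma> \<circ> tr a \<circ> tr b = \<sigma> \<circ> tr b \<circ> tr a" for \<sigma> :: "nat \<Rightarrow> nat"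
    using assms by (auto simp: fun_eq_iff tr_def)
  have "tr a b = b" "tr a (Suc b) = Suc b" "tr b a = a" "tr b (Suc a) = Suc a"
    using assms by (auto simp: tr_def)
  then show ?thesis
    by (auto simp: hop_def fun_eq_iff algebra_simps c)
qed

text \<open>The Yang--Baxter relation with denominators cleared: \<open>(1 - y) + (x - y) u\<close>
  is \<open>1 - y\<close> times \<open>(1 + x u)(1 + y u)^-1\<close>. Which correction terms occur
  depends only on the relative order of three consecutive values of \<open>\<sigma>\<close>, hence
  six cases.\<close>

lemma hop_Yang_Baxter:
  "hop (Suc a) (1 - y) (x - y) (hop a 1 x (hop (Suc a) 1 y \<phi>)) =
   hop a 1 y (hop (Suc a) 1 x (hop a (1 - y) (x - y) \<phi>))"
proof
  fix \<sigma> :: "nat \<Rightarrow> nat"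
  have c: "\<sigma> \<circ> tr (Suc a) \<circ> tr a \<circ> tr (Suc a) = \<sigma> \<circ> tr a \<circ> tr (Suc a) \<circ> tr a"
    by (auto simp: fun_eq_iff tr_def)
  have t: "tr a (Suc (Suc a)) = Suc (Suc a)" "tr (Suc a) a = a"
    by (auto simp: tr_def)
  consider "\<sigma> a \<le> \<sigma> (Suc a)" "\<sigma> (Suc a) \<le> \<sigma> (Suc (Suc a))"
    | "\<sigma> a \<le> \<sigma> (Suc a)" "\<sigma> (Suc (Suc a)) < \<sigma> (Suc a)" "\<sigma> a \<le> \<sigma> (Suc (Suc a))"
    | "\<sigma> a \<le> \<sigma> (Suc a)" "\<sigma> (Suc (Suc a)) < \<sigma> a"
    | "\<sigma> (Suc a) < \<sigma> a" "\<sigma> a \<le> \<sigma> (Suc (Suc a))"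
    | "\<sigma> (Suc a) < \<sigma> a" "\<sigma> (Suc (Suc a)) < \<sigma> a" "\<sigma> (Suc a) \<le> \<sigma> (Suc (Suc a))"
    | "\<sigma> (Suc a) < \<sigma> a" "\<sigma> (Suc (Suc a)) < \<sigma> (Suc a)"
    by linarith
  then show "hop (Suc a) (1 - y) (x - y) (hop a 1 x (hop (Suc a) 1 y \<phi>)) \<sigma> =
      hop a 1 y (hop (Suc a) 1 x (hop a (1 - y) (x - y) \<phi>)) \<sigma>"
    by cases (simp_all add: hop_def t c algebra_simps)
qed

section \<open>Rows of letters and their commutation\<close>

primrec rowop :: "nat \<Rightarrow> nat \<Rightarrow> 'a \<Rightarrow> ((nat \<Rightarrow> nat) \<Rightarrow> 'a::comm_ring_1) \<Rightarrow> (nat \<Rightarrow> nat) \<Rightarrow> 'a" where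
  "rowop i 0 x \<phi> = \<phi>"
| "rowop i (Suc k) x \<phi> = hop (i + k) 1 x (rowop i k x \<phi>)"

text \<open>The recursion adds the outermost letter; Yang--Baxter needs the innermost letter
  \<open>i\<close> split off.\<close>

lemma rowop_Suc_inner: "rowop i (Suc k) x \<phi> = rowop (Suc i) k x (hop i 1 x \<phi>)"
  by (induction k) simp_all

lemma rowop_scale: "rowop i k x (\<lambda>\<sigma>. c * \<phi> \<sigma>) = (\<lambda>\<sigma>. c * rowop i k x \<phi> \<sigma>)"
  by (induction k) (simp_all add: hop_scale)

lemma rowop_hop_commute:
  assumes "Suc a < i"
  shows "rowop i k x (hop a s y \<phi>) = hop a s y (rowop i k x \<phi>)"
proof (induction k)
  case (Suc k)
  then show ?case
    using assms hop_commute_far[of a "i + k" s y 1 x "rowop i k x \<phi>"] by simp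
qed simp

text \<open>Two-step induction: the row at \<open>i\<close> is the row at \<open>i + 2\<close> (this
  is \<open>C\<close>) followed by the letters \<open>i + 1\<close> and \<open>i\<close>. The
  induction hypothesis for the row at \<open>i + 1\<close> exchanges \<open>x\<close> and
  \<open>y\<close> at the cost of a factor in the letter \<open>i + 1\<close>, which Yang--Baxter
  turns into a factor in the letter \<open>i\<close>. The scalar \<open>1 - y\<close> is cancelled
  at the end.\<close>

lemma rowop_commute:
  fixes x y :: "'a::idom"
  assumes "y \<noteq> 1"
  shows "rowop i k x (rowop i k y \<phi>) = rowop i k y (rowop i k x \<phi>)"
proof (induction k arbitrary: i \<phi> rule: induct_nat_012)
  case 0
  show ?case by simp
next
  case 1
  show ?case by (simp add: hop_hop algebra_simps)
next
  case (ge2 k)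
  define B :: "'a \<Rightarrow> _" where "B = rowop (Suc i) (Suc k)"
  define C :: "'a \<Rightarrow> _" where "C = rowop (Suc (Suc i)) k"
  have B: "B z \<psi> = C z (hop (Suc i) 1 z \<psi>)" for z :: 'a and \<psi>
    unfolding B_def C_def by (rule rowop_Suc_inner)
  have A: "rowop i (Suc (Suc k)) z \<psi> = B z (hop i 1 z \<psi>)" for z :: 'a and \<psi>
    unfolding B_def by (rule rowop_Suc_inner)
  have IH: "B x (B y \<psi>) = B y (B x \<psi>)" for \<psi>
    unfolding B_def by (rule ge2.IH)
  have Chop: "C z (hop i s u \<psi>) = hop i s u (C z \<psi>)" for z s u :: 'a and \<psi>
    unfolding C_def by (rule rowop_hop_commute) simp
  have Bs: "B z (\<lambda>\<sigma>. c * \<psi> \<sigma>) = (\<lambda>\<sigma>. c * B z \<psi> \<sigma>)" for z c :: 'a and \<psi>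
    unfolding B_def by (rule rowop_scale)
  have Cs: "C z (\<lambda>\<sigma>. c * \<psi> \<sigma>) = (\<lambda>\<sigma>. c * C z \<psi> \<sigma>)" for z c :: 'a and \<psi>
    unfolding C_def by (rule rowop_scale)
  have scale: "hop a s 0 \<psi> = (\<lambda>\<sigma>. s * \<psi> \<sigma>)" for a and s :: 'a and \<psi>
    by (auto simp: hop_def fun_eq_iff)
  \<comment> \<open>The factor \<open>1 - y\<close> avoids dividing by it, i.e. inverting \<open>1 + y u\<close>.\<close>
  have move: "(\<lambda>\<sigma>. (1 - y) * B x (C y \<psi>) \<sigma>) = B y (C x (hop (Suc i) (1 - y) (x - y) \<psi>))" for \<psi>
  proof -
    \<comment> \<open>Applying \<open>1 + y u\<close> to \<open>\<psi>'\<close> gives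
      \<open>(1 - y) \<psi>\<close>, so the induction hypothesis at \<open>\<psi>'\<close> strips
      the letter \<open>Suc i\<close> from \<open>B y\<close>.\<close>
    define \<psi>' where "\<psi>' = hop (Suc i) (1 - y) (- y) \<psi>"
    have "hop (Suc i) 1 y \<psi>' = hop (Suc i) (1 - y) 0 \<psi>"
      unfolding \<psi>'_def hop_hop by (simp add: algebra_simps)
    then have "B y \<psi>' = (\<lambda>\<sigma>. (1 - y) * C y \<psi> \<sigma>)"
      by (simp only: B scale Cs)
    moreover have "hop (Suc i) 1 x \<psi>' = hop (Suc i) (1 - y) (x - y) \<psi>"
      unfolding \<psi>'_def hop_hop by (simp add: algebra_simps)
    then have "B x \<psi>' = C x (hop (Suc i) (1 - y) (x - y) \<psi>)"
      by (simp only: B)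
    ultimately show ?thesis
      using IH[of \<psi>'] by (simp only: Bs)
  qed
  have "(\<lambda>\<sigma>. (1 - y) * rowop i (Suc (Suc k)) x (rowop i (Suc (Suc k)) y \<phi>) \<sigma>) =
    (\<lambda>\<sigma>. (1 - y) * B x (C y (hop i 1 x (hop (Suc i) 1 y (hop i 1 y \<phi>)))) \<sigma>)"
    by (simp only: A B[of y] Chop)
  also have "\<dots> = B y (C x (hop i 1 y (hop (Suc i) 1 x (hop i (1 - y) (x - y) (hop i 1 y \<phi>)))))"
    by (simp only: move hop_Yang_Baxter)
  also have "hop i (1 - y) (x - y) (hop i 1 y \<phi>) = hop i (1 - y) 0 (hop i 1 x \<phi>)"
    unfolding hop_hop by (simp add: algebra_simps)
  also have "\<dots> = (\<lambda>\<sigma>. (1 - y) * hop i 1 x \<phi> \<sigma>)"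
    by (rule scale)
  also have "B y (C x (hop i 1 y (hop (Suc i) 1 x (\<lambda>\<sigma>. (1 - y) * hop i 1 x \<phi> \<sigma>)))) =
    (\<lambda>\<sigma>. (1 - y) * B y (hop i 1 y (B x (hop i 1 x \<phi>))) \<sigma>)"
    by (simp only: hop_scale Cs Bs Chop B[of x])
  also have "\<dots> = (\<lambda>\<sigma>. (1 - y) * rowop i (Suc (Suc k)) y (rowop i (Suc (Suc k)) x \<phi>) \<sigma>)"
    by (simp only: A)
  finally show ?case
    using assms by (simp add: fun_eq_iff)
qed

text \<open>Right multiplication by \<open>1 + y u\<^sub>b\<close>. The guard \<open>bij \<sigma>\<close> makes it commute with \<open>hop\<close> at all
  arguments.\<close>
definition rop :: "nat \<Rightarrow> 'a \<Rightarrow> ((nat \<Rightarrow> nat) \<Rightarrow> 'a::comm_ring_1) \<Rightarrow> (nat \<Rightarrow> nat) \<Rightarrow> 'a" where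
  "rop b y \<phi> \<sigma> = \<phi> \<sigma> +
     (if bij \<sigma> \<and> inv \<sigma> (Suc b) < inv \<sigma> b then y * (\<phi> (tr b \<circ> \<sigma>) - \<phi> \<sigma>) else 0)"

lemma bij_comp_tr_iff [simp]: "bij (\<sigma> \<circ> tr a) \<longleftrightarrow> bij \<sigma>"
  using bij_comp[OF bij_tr, of "\<sigma> \<circ> tr a" a] bij_comp[OF bij_tr, of \<sigma> a] by auto

lemma inv_comp_tr: "bij \<sigma> \<Longrightarrow> inv (\<sigma> \<circ> tr a) = tr a \<circ> inv \<sigma>"
  by (simp add: o_inv_distrib)

lemma inv_tr_comp: "bij \<sigma> \<Longrightarrow> inv (tr a \<circ> \<sigma>) = inv \<sigma> \<circ> tr a"
  by (simp add: o_inv_distrib)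

text \<open>Associativity of the product. The two multiplications interact only if
  \<open>w = inv \<sigma>\<close> carries \<open>a\<close> and \<open>Suc a\<close> at the positions
  \<open>b\<close> and \<open>Suc b\<close>; then both transpositions give the same permutation.
  Otherwise neither affects the descent tested by the other.\<close>

lemma rop_hop_commute: "rop b y (hop a s x \<phi>) = hop a s x (rop b y \<phi>)"
proof
  fix \<sigma> :: "nat \<Rightarrow> nat"
  show "rop b y (hop a s x \<phi>) \<sigma> = hop a s x (rop b y \<phi>) \<sigma>"
  proof (cases "bij \<sigma>")
    case False
    then show ?thesis
      by (simp add: rop_def hop_def)
  next
    case True
    have eq: "inv \<sigma> u = v \<longleftrightarrow> u = \<sigma> v" for u v
      using True by (metis bij_inv_eq_iff)
    show ?thesis
    proof (cases "{inv \<sigma> b, inv \<sigma> (Suc b)} = {a, Suc a}")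
      case swapped: True
      then have "tr b (\<sigma> u) = \<sigma> (tr a u)" for u
        using eq inj_eq[OF bij_is_inj[OF True]] by (auto simp: tr_def doubleton_eq_iff)
      then have "tr b \<circ> \<sigma> = \<sigma> \<circ> tr a"
        by (auto simp: fun_eq_iff)
      moreover have "inv \<sigma> b = a \<and> inv \<sigma> (Suc b) = Suc a \<and> \<sigma> a = b \<and> \<sigma> (Suc a) = Suc b \<or>
          inv \<sigma> b = Suc a \<and> inv \<sigma> (Suc b) = a \<and> \<sigma> a = Suc b \<and> \<sigma> (Suc a) = b"
        using swapped eq by (auto simp: doubleton_eq_iff)
      ultimately show ?thesis
        using True by (auto simp: rop_def hop_def inv_comp_tr algebra_simps)
    next
      case False
      have ne: "inv \<sigma> b \<noteq> inv \<sigma> (Suc b)"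
        using True by (metis eq n_not_Suc_n)
      have ne': "\<sigma> a \<noteq> \<sigma> (Suc a)"
        using eq by (metis n_not_Suc_n)
      have r: "tr a (inv \<sigma> (Suc b)) < tr a (inv \<sigma> b) \<longleftrightarrow> inv \<sigma> (Suc b) < inv \<sigma> b"
        using False ne by (auto simp: tr_def doubleton_eq_iff)
      have F': "{\<sigma> a, \<sigma> (Suc a)} \<noteq> {b, Suc b}"
        using False eq by (auto simp: doubleton_eq_iff)
      have l: "tr b (\<sigma> (Suc a)) < tr b (\<sigma> a) \<longleftrightarrow> \<sigma> (Suc a) < \<sigma> a"
        using F' ne' by (auto simp: tr_def doubleton_eq_iff)
      show ?thesis
        using True by (simp add: rop_def hop_def inv_comp_tr r l o_assoc algebra_simps)
    qed
  qed
qed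

lemma rop_rowop_commute: "rop b y (rowop i k x \<phi>) = rowop i k x (rop b y \<phi>)"
  by (induction k) (simp_all add: rop_hop_commute)

section \<open>The full product and its symmetry in neighbouring variables\<close>

definition delta :: "(nat \<Rightarrow> nat) \<Rightarrow> 'a::comm_ring_1" where
  "delta \<sigma> = (if \<sigma> = id then 1 else 0)"

lemma rop_delta: "rop b y delta = hop b 1 y delta"
proof
  fix \<sigma> :: "nat \<Rightarrow> nat"
  have "\<sigma> \<circ> tr b = id \<longleftrightarrow> \<sigma> = tr b" "tr b \<circ> \<sigma> = id \<longleftrightarrow> \<sigma> = tr b"
    by (metis comp_tr_tr comp_id id_comp)+
  then show "rop b y delta \<sigma> = hop b 1 y delta \<sigma>"
    by (auto simp: rop_def hop_def delta_def)
qed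

text \<open>The coefficients of \<open>A\<^sub>i(X\<^sub>i) \<dots> A\<^sub>n\<^sub>-\<^sub>1(X\<^sub>n\<^sub>-\<^sub>1)\<close> with \<open>n = i + k\<close>.\<close>
primrec Phi :: "nat \<Rightarrow> nat \<Rightarrow> (nat \<Rightarrow> 'a) \<Rightarrow> (nat \<Rightarrow> nat) \<Rightarrow> 'a::comm_ring_1" where
  "Phi i 0 X = delta"
| "Phi i (Suc k) X = rowop i (Suc k) (X i) (Phi (Suc i) k X)"

text \<open>All letters of the product are at least \<open>i\<close>, so the letter \<open>b\<close>
  commutes with them and passes from the right end to the left end.\<close>

lemma rop_Phi:
  assumes "Suc b < i"
  shows "rop b y (Phi i k X) = hop b 1 y (Phi i k X)"
  using assms
proof (induction k arbitrary: i)
  case 0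
  show ?case by (simp add: rop_delta)
next
  case (Suc k)
  then show ?case
    by (simp add: rop_rowop_commute rop_hop_commute rowop_hop_commute hop_commute_far
          del: rowop.simps Phi.simps(1))
qed

lemma Phi_cong:
  assumes "\<And>r. i \<le> r \<Longrightarrow> X r = Y r"
  shows "Phi i k X = Phi i k Y"
  using assms by (induction k arbitrary: i) (simp_all del: rowop.simps)

text \<open>The right factor in the letter \<open>j\<close> moves past the later rows and completes
  row \<open>Suc j\<close> to a second row starting at \<open>j\<close>. Two such rows commute, so
  their variables may be exchanged.\<close>

lemma rop_Phi_symmetric:
  fixes X :: "nat \<Rightarrow> 'a::idom"
  assumes "i \<le> j" "j < i + k" "X (Suc j) \<noteq> 1"
  shows "rop j (X (Suc j)) (Phi i k X) = rop j (X j) (Phi i k (X \<circ> tr j))"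
  using assms(1,2)
proof (induction k arbitrary: i)
  case (Suc k)
  show ?case
  proof (cases "i = j")
    case False
    then show ?thesis
      using Suc by (simp add: rop_rowop_commute del: rowop.simps)
  next
    case True
    show ?thesis
    proof (cases k)
      \<comment> \<open>Only the row of the single letter \<open>j\<close> is left; the factor
        multiplied on the right acts as the second row.\<close>
      case 0
      then show ?thesis
        using True by (simp add: rop_hop_commute rop_delta hop_hop algebra_simps)
    next
      case k: (Suc k')
      define \<psi> where "\<psi> = Phi (Suc (Suc j)) k' X"
      have \<psi>': "Phi (Suc (Suc j)) k' (X \<circ> tr j) = \<psi>"
        unfolding \<psi>_def by (rule Phi_cong) simp
      have *: "rop j y (rowop j (Suc (Suc k')) x (rowop (Suc j) (Suc k') y \<psi>)) =
          rowop j (Suc (Suc k')) x (rowop j (Suc (Suc k')) y \<psi>)" for x y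
        unfolding rop_rowop_commute
        by (simp add: \<psi>_def rop_Phi rowop_Suc_inner del: rowop.simps)
      have Phi: "Phi j (Suc (Suc k')) Y = rowop j (Suc (Suc k')) (Y j)
          (rowop (Suc j) (Suc k') (Y (Suc j)) (Phi (Suc (Suc j)) k' Y))" for Y :: "nat \<Rightarrow> 'a"
        by (simp del: rowop.simps)
      have "(X \<circ> tr j) j = X (Suc j)" "(X \<circ> tr j) (Suc j) = X j"
        by simp_all
      then show ?thesis
        unfolding True k Phi \<psi>' \<psi>_def[symmetric] * by (simp only: * rowop_commute[OF assms(3)])
    qed
  qed
qed simp

section \<open>Divided differences\<close>

lemma lookup_swap_mono [simp]: "Poly_Mapping.lookup (swap_mono j a) i = Poly_Mapping.lookup a (tr j i)"
proof -
  have "{i. Poly_Mapping.lookup a (tr j i) \<noteq> 0} = tr j ` Poly_Mapping.keys a"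
    by (force simp: in_keys_iff image_iff intro: exI[of _ "tr j _"])
  then show ?thesis
    by (simp add: swap_mono_def)
qed

lemma swap_mono_swap_mono [simp]: "swap_mono j (swap_mono j a) = a"
  by (simp add: poly_mapping_eqI)

lemma swap_mono_add: "swap_mono j (a + b) = swap_mono j a + swap_mono j b"
  by (simp add: poly_mapping_eqI lookup_add)

lemma bij_swap_mono: "bij (swap_mono j)"
  by (rule involuntory_imp_bij) simp

lemma swap_mono_eq_iff [simp]: "swap_mono j a = swap_mono j b \<longleftrightarrow> a = b"
  by (metis swap_mono_swap_mono)

lemma lookup_swap_poly [simp]: "Poly_Mapping.lookup (swap_poly j f) a = Poly_Mapping.lookup f (swap_mono j a)"
proof -
  have "{a. Poly_Mapping.lookup f (swap_mono j a) \<noteq> 0} = swap_mono j ` Poly_Mapping.keys f"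
    by (force simp: in_keys_iff image_iff intro: exI[of _ "swap_mono j _"])
  then show ?thesis
    by (simp add: swap_poly_def)
qed

lemma swap_poly_add: "swap_poly j (f + g) = swap_poly j f + swap_poly j g"
  by (simp add: poly_mapping_eqI lookup_add)

lemma swap_poly_minus: "swap_poly j (f - g) = swap_poly j f - swap_poly j g"
  by (simp add: poly_mapping_eqI lookup_minus)

lemma swap_poly_0 [simp]: "swap_poly j 0 = 0"
  by (simp add: poly_mapping_eqI)

lemma swap_mono_eq_0_iff [simp]: "swap_mono j a = 0 \<longleftrightarrow> a = 0"
proof -
  have "swap_mono j 0 = 0"
    by (simp add: poly_mapping_eqI)
  then show ?thesis
    by (metis swap_mono_swap_mono)
qed

lemma swap_poly_1 [simp]: "swap_poly j 1 = 1"
  by (rule poly_mapping_eqI) (simp add: lookup_one when_def)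

text \<open>Both convolution sums are reindexed along the bijection
  \<open>swap_mono j\<close>.\<close>

lemma swap_poly_mult: "swap_poly j (f * g) = swap_poly j f * swap_poly j g"
proof (rule poly_mapping_eqI)
  fix k :: mono
  have inner: "(\<Sum>q. Poly_Mapping.lookup g q when swap_mono j k = swap_mono j l + q) =
      (\<Sum>q. Poly_Mapping.lookup g (swap_mono j q) when k = l + q)" for l
    by (rule Sum_any.reindex_cong[OF bij_swap_mono[of j]])
       (auto simp: fun_eq_iff when_def simp flip: swap_mono_add)
  have "(\<Sum>l. Poly_Mapping.lookup f l * (\<Sum>q. Poly_Mapping.lookup g q when swap_mono j k = l + q)) =
      (\<Sum>l. Poly_Mapping.lookup f (swap_mono j l) * (\<Sum>q. Poly_Mapping.lookup g (swap_mono j q) when k = l + q))"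
    by (rule Sum_any.reindex_cong[OF bij_swap_mono[of j]]) (auto simp: fun_eq_iff inner)
  then show "Poly_Mapping.lookup (swap_poly j (f * g)) k = Poly_Mapping.lookup (swap_poly j f * swap_poly j g) k"
    by (simp add: lookup_mult)
qed

lemma swap_poly_Xv: "swap_poly j (Xv i) = Xv (tr j i)"
proof (rule poly_mapping_eqI)
  fix a :: mono
  have "swap_mono j (Poly_Mapping.single (tr j i) (1::nat)) = Poly_Mapping.single i 1"
    by (rule poly_mapping_eqI) (auto simp: lookup_single when_def tr_def)
  then have "Poly_Mapping.single i (1::nat) = swap_mono j a \<longleftrightarrow> Poly_Mapping.single (tr j i) 1 = a"
    by (metis swap_mono_swap_mono)
  then show "Poly_Mapping.lookup (swap_poly j (Xv i)) a = Poly_Mapping.lookup (Xv (tr j i)) a"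
    by (simp only: Xv_def lookup_swap_poly lookup_single)
qed

lemma swap_poly_hop:
  "swap_poly j (hop a s x \<phi> \<sigma>) = hop a (swap_poly j s) (swap_poly j x) (\<lambda>\<sigma>. swap_poly j (\<phi> \<sigma>)) \<sigma>"
  by (simp add: hop_def swap_poly_add swap_poly_minus swap_poly_mult)

lemma swap_poly_rowop:
  "swap_poly j (rowop i k x \<phi> \<sigma>) = rowop i k (swap_poly j x) (\<lambda>\<sigma>. swap_poly j (\<phi> \<sigma>)) \<sigma>"
proof (induction k arbitrary: \<sigma>)
  case (Suc k)
  then show ?case
    by (simp add: swap_poly_hop)
qed simp

lemma swap_poly_Phi: "swap_poly j (Phi i k X \<sigma>) = Phi i k (\<lambda>r. swap_poly j (X r)) \<sigma>"
proof (induction k arbitrary: i \<sigma>)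
  case 0
  show ?case by (simp add: delta_def)
next
  case (Suc k)
  then show ?case
    by (simp add: swap_poly_rowop del: rowop.simps)
qed

lemma Xv_eq_iff [simp]: "Xv i = Xv j \<longleftrightarrow> i = j"
proof
  assume "Xv i = Xv j"
  then have "Poly_Mapping.lookup (Xv i) (Poly_Mapping.single i 1) = Poly_Mapping.lookup (Xv j) (Poly_Mapping.single i 1)"
    by simp
  then have "Poly_Mapping.single j (1::nat) = Poly_Mapping.single i 1"
    by (simp add: Xv_def lookup_single when_def split: if_splits)
  then have "Poly_Mapping.lookup (Poly_Mapping.single j (1::nat)) i = 1"
    by simp
  then show "i = j"
    by (simp add: lookup_single when_def split: if_splits)
qed simp

lemma Xv_neq_1: "Xv i \<noteq> 1"
proof
  assume "Xv i = 1"
  then have "Poly_Mapping.lookup (Xv i) 0 = 1"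
    by simp
  then have "Poly_Mapping.single i (1::nat) = 0"
    by (simp add: Xv_def lookup_single when_def split: if_splits)
  then show False
    by (metis lookup_single_eq lookup_zero zero_neq_one)
qed

text \<open>Integer polynomials form a domain and the two variables differ, so the quotient in the
  definite description is unique.\<close>

lemma ddiff_eqI:
  assumes "(Xv j - Xv (Suc j)) * g = f - swap_poly j f"
  shows "ddiff j f = g"
  unfolding ddiff_def
proof (rule the_equality)
  fix h
  assume "(Xv j - Xv (Suc j)) * h = f - swap_poly j f"
  then have "(Xv j - Xv (Suc j)) * h = (Xv j - Xv (Suc j)) * g"
    using assms by simp
  then show "h = g"
    by simp
qed (fact assms)

text \<open>The exchange symmetry is read off at two coefficients. At \<open>\<sigma>\<close> it
  says that \<open>P \<sigma>\<close> is symmetric in the two variables. At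
  \<open>\<sigma>'\<close>, the inverse of \<open>w s_j\<close> for \<open>w = inv \<sigma>\<close>,
  it becomes \<open>(1 - x_{j+1}) P \<sigma>' - (1 - x_j) Q \<sigma>' = (x_j - x_{j+1}) P
  \<sigma>\<close>, which is the divided difference.\<close>

lemma dbar_Phi:
  assumes "bij \<sigma>" "inv \<sigma> j < inv \<sigma> (Suc j)" "i \<le> j" "j < i + k"
  shows "dbar j (Phi i k Xv (tr j \<circ> \<sigma>)) = Phi i k Xv \<sigma>"
proof -
  define \<sigma>' where "\<sigma>' = tr j \<circ> \<sigma>"
  define P where "P = Phi i k Xv"
  define Q where "Q = Phi i k (Xv \<circ> tr j)"
  have b: "bij \<sigma>'"
    unfolding \<sigma>'_def by (intro bij_comp assms bij_tr)
  have "inv \<sigma>' = inv \<sigma> \<circ> tr j"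
    unfolding \<sigma>'_def by (rule inv_tr_comp) fact
  then have desc: "inv \<sigma>' (Suc j) < inv \<sigma>' j"
    using assms by simp
  have sym: "rop j (Xv (Suc j)) P = rop j (Xv j) Q"
    unfolding P_def Q_def by (rule rop_Phi_symmetric[OF assms(3,4) Xv_neq_1])
  have "rop j (Xv (Suc j)) P \<sigma> = rop j (Xv j) Q \<sigma>"
    by (simp add: sym)
  then have 1: "Q \<sigma> = P \<sigma>"
    using assms by (simp add: rop_def)
  have "rop j (Xv (Suc j)) P \<sigma>' = rop j (Xv j) Q \<sigma>'"
    by (simp add: sym)
  moreover have "tr j \<circ> \<sigma>' = \<sigma>"
    by (simp add: \<sigma>'_def)
  ultimately have 2: "P \<sigma>' + Xv (Suc j) * (P \<sigma> - P \<sigma>') = Q \<sigma>' + Xv j * (P \<sigma> - Q \<sigma>')"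
    using b desc 1 by (simp add: rop_def)
  have sw: "swap_poly j ((1 - Xv (Suc j)) * P \<sigma>') = (1 - Xv j) * Q \<sigma>'"
    by (simp add: swap_poly_mult swap_poly_minus swap_poly_Phi swap_poly_Xv P_def Q_def comp_def)
  have "ddiff j ((1 - Xv (Suc j)) * P \<sigma>') = P \<sigma>"
    by (rule ddiff_eqI) (unfold sw, use 2 in \<open>simp add: algebra_simps\<close>)
  then show ?thesis
    by (simp add: dbar_def P_def \<sigma>'_def)
qed

section \<open>Vanishing coefficients and the longest permutation\<close>

lemma rowop_eq_0:
  assumes "\<And>\<sigma>. \<sigma> p \<noteq> p \<Longrightarrow> \<phi> \<sigma> = 0" "p < i" "\<sigma> p \<noteq> p"
  shows "rowop i k x \<phi> \<sigma> = 0"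
  using assms(3)
proof (induction k arbitrary: \<sigma>)
  case (Suc k)
  have "tr (i + k) p = p"
    using assms(2) by simp
  then show ?case
    using Suc by (simp add: hop_def)
qed (simp add: assms(1))

text \<open>No letter of the product moves a point below \<open>i\<close>.\<close>

lemma Phi_eq_0: "p < i \<Longrightarrow> \<sigma> p \<noteq> p \<Longrightarrow> Phi i k X \<sigma> = 0"
proof (induction k arbitrary: i \<sigma>)
  case 0
  then show ?case by (auto simp: delta_def)
next
  case (Suc k)
  then show ?case
    unfolding Phi.simps by (intro rowop_eq_0[where p = p]) auto
qed

text \<open>Letters below \<open>i + k\<close> cannot move the value \<open>i\<close> away from
  position \<open>p\<close>, whereas \<open>\<phi>\<close> demands it at position
  \<open>i\<close>.\<close>

lemma rowop_eq_0_above: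
  assumes "\<And>\<sigma>. \<sigma> i \<noteq> i \<Longrightarrow> \<phi> \<sigma> = 0" "inj \<sigma>" "\<sigma> p = i" "i + k < p"
  shows "rowop i k x \<phi> \<sigma> = 0"
  using assms(2-)
proof (induction k arbitrary: \<sigma>)
  case 0
  then have "\<sigma> i \<noteq> i"
    by (metis add.right_neutral injD less_irrefl)
  then show ?case
    by (simp add: assms(1))
next
  case (Suc k)
  have "inj (\<sigma> \<circ> tr (i + k))"
    by (intro inj_compose Suc.prems bij_is_inj bij_tr)
  moreover have "tr (i + k) p = p"
    using Suc.prems by (intro tr_simps) auto
  ultimately show ?case
    using Suc by (simp add: hop_def)
qed

lemma permutes_comp_tr:
  assumes "\<sigma> permutes {i..n}" "i \<le> j" "j < n"
  shows "\<sigma> \<circ> tr j permutes {i..n}"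
proof -
  have "tr j = transpose j (Suc j)"
    by (auto simp: tr_def transpose_def fun_eq_iff)
  then show ?thesis
    using assms by (auto intro!: permutes_compose permutes_swap_id)
qed

text \<open>The value \<open>i\<close> has to travel from position \<open>i + k\<close> to position
  \<open>i\<close>, one step per letter. Skipping a letter or using it in place leaves
  \<open>i\<close> out of reach by \<open>rowop_eq_0_above\<close>, so a single term
  survives.\<close>

lemma rowop_decreasing:
  assumes "\<And>\<sigma>. \<sigma> i \<noteq> i \<Longrightarrow> \<phi> \<sigma> = 0"
    and "\<sigma> permutes {i..n}" "i + k \<le> n" "\<sigma> (i + k) = i"
    and "\<And>a b. \<lbrakk>i \<le> a; a < b; b \<le> n; a \<noteq> i + k; b \<noteq> i + k\<rbrakk> \<Longrightarrow> \<sigma> b < \<sigma> a"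
  obtains \<tau> where "rowop i k x \<phi> \<sigma> = x ^ k * \<phi> \<tau>" "\<tau> permutes {i..n}" "\<tau> i = i"
    "\<And>a b. \<lbrakk>i < a; a < b; b \<le> n\<rbrakk> \<Longrightarrow> \<tau> b < \<tau> a"
  using assms(2-)
proof (induction k arbitrary: \<sigma> thesis)
  case 0
  show ?case
    by (rule 0(1)[of \<sigma>]) (use 0 in auto)
next
  case (Suc k)
  let ?j = "i + k"
  let ?\<sigma> = "\<sigma> \<circ> tr ?j"
  have perm: "?\<sigma> permutes {i..n}"
    using Suc.prems by (intro permutes_comp_tr) auto
  have dec: "?\<sigma> b < ?\<sigma> a" if "i \<le> a" "a < b" "b \<le> n" "a \<noteq> ?j" "b \<noteq> ?j" for a b
  proof -
    consider "a = Suc ?j" | "b = Suc ?j" | "a \<noteq> Suc ?j" "b \<noteq> Suc ?j"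
      by auto
    then show ?thesis
    proof cases
      case 1
      then show ?thesis using Suc.prems(5)[of ?j b] that by simp
    next
      case 2
      then show ?thesis using Suc.prems(5)[of a ?j] that by simp
    next
      case 3
      then show ?thesis using Suc.prems(5)[of a b] that by simp
    qed
  qed
  obtain \<tau> where \<tau>: "rowop i k x \<phi> ?\<sigma> = x ^ k * \<phi> \<tau>" "\<tau> permutes {i..n}" "\<tau> i = i"
    "\<And>a b. \<lbrakk>i < a; a < b; b \<le> n\<rbrakk> \<Longrightarrow> \<tau> b < \<tau> a"
    by (rule Suc.IH[OF _ perm]) (use Suc.prems(3,4) dec in auto)
  have "\<sigma> ?j \<in> {i..n}"
    using Suc.prems(2,3) by (subst permutes_in_image) auto
  moreover have "\<sigma> ?j \<noteq> \<sigma> (Suc ?j)"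
    using permutes_inj[OF Suc.prems(2)] by (metis injD n_not_Suc_n)
  ultimately have "\<sigma> (Suc ?j) < \<sigma> ?j"
    using Suc.prems(4) by auto
  moreover have "rowop i k x \<phi> \<sigma> = 0"
    using rowop_eq_0_above[OF assms(1) permutes_inj[OF Suc.prems(2)] Suc.prems(4)] by simp
  ultimately have "rowop i (Suc k) x \<phi> \<sigma> = x ^ Suc k * \<phi> \<tau>"
    by (simp add: hop_def \<tau>(1))
  then show ?case
    using Suc.prems(1) \<tau>(2-) by blast
qed

lemma permutes_Suc:
  assumes "\<tau> permutes {i..n}" "\<tau> i = i"
  shows "\<tau> permutes {Suc i..n}"
  by (rule permutes_superset[OF assms(1)]) (use assms in \<open>auto simp: not_less_eq_eq\<close>)

text \<open>This supplies the initial value \<open>top_poly\<close>; each row contributes its full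
  power by \<open>rowop_decreasing\<close>.\<close>

lemma Phi_decreasing:
  assumes "\<sigma> permutes {i..i + k}"
    and "\<And>a b. \<lbrakk>i \<le> a; a < b; b \<le> i + k\<rbrakk> \<Longrightarrow> \<sigma> b < \<sigma> a"
  shows "Phi i k X \<sigma> = (\<Prod>r\<in>{i..<i + k}. X r ^ (i + k - r))"
  using assms
proof (induction k arbitrary: i \<sigma>)
  case 0
  then show ?case by (simp add: delta_def id_def)
next
  case (Suc k)
  have top: "\<sigma> (i + Suc k) = i"
  proof -
    obtain p where p: "p \<in> {i..i + Suc k}" "\<sigma> p = i"
      using permutes_image[OF Suc.prems(1)] by (metis atLeastAtMost_iff imageE le_add1 order_refl)
    have "\<sigma> (i + Suc k) \<in> {i..i + Suc k}"
      using Suc.prems(1) by (subst permutes_in_image) auto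
    then show ?thesis
      using Suc.prems(2)[of p "i + Suc k"] p by (cases "p = i + Suc k") auto
  qed
  have vanish: "Phi (Suc i) k X \<sigma> = 0" if "\<sigma> i \<noteq> i" for \<sigma>
    using that by (intro Phi_eq_0) auto
  obtain \<tau> where \<tau>: "rowop i (Suc k) (X i) (Phi (Suc i) k X) \<sigma> = X i ^ Suc k * Phi (Suc i) k X \<tau>"
    "\<tau> permutes {i..i + Suc k}" "\<tau> i = i" "\<And>a b. \<lbrakk>i < a; a < b; b \<le> i + Suc k\<rbrakk> \<Longrightarrow> \<tau> b < \<tau> a"
    by (rule rowop_decreasing[OF vanish Suc.prems(1) order_refl top]) (use Suc.prems(2) in auto)
  have "Phi (Suc i) k X \<tau> = (\<Prod>r\<in>{Suc i..<Suc i + k}. X r ^ (Suc i + k - r))"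
    by (rule Suc.IH) (use \<tau> permutes_Suc in auto)
  moreover have "{i..<i + Suc k} = insert i {Suc i..<Suc i + k}"
    by auto
  ultimately show ?case
    using \<tau>(1) by simp
qed

section \<open>Non-inversions and the recursion for \<open>groth\<close>\<close>

lemma ninv_comp_tr:
  assumes "1 \<le> j" "j < n" "w j < w (Suc j)"
  shows "ninv n w = Suc (ninv n (w \<circ> tr j))"
proof -
  define S where "S v = {(i, k). 1 \<le> i \<and> i < k \<and> k \<le> n \<and> v i < v k}" for v :: "nat \<Rightarrow> nat"
  define h where "h = map_prod (tr j) (tr j)"
  have fin: "finite (S v)" for v
    by (rule finite_subset[of _ "{1..n} \<times> {1..n}"]) (auto simp: S_def)
  have hh: "h (h p) = p" for p
    by (cases p) (simp add: h_def)
  \<comment> \<open>Exchanging \<open>j\<close> and \<open>Suc j\<close> in both components keeps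
    every pair ordered except \<open>(j, Suc j)\<close>, the one non-inversion that is lost.\<close>
  have ord: "1 \<le> tr j i \<and> tr j i < tr j k \<and> tr j k \<le> n"
    if "1 \<le> i" "i < k" "k \<le> n" "(i, k) \<noteq> (j, Suc j)" for i k
    using that assms by (auto simp: tr_def)
  have sub1: "h p \<in> S w - {(j, Suc j)}" if "p \<in> S (w \<circ> tr j)" for p
  proof -
    obtain i k where p: "p = (i, k)" "1 \<le> i" "i < k" "k \<le> n" "w (tr j i) < w (tr j k)"
      using \<open>p \<in> S (w \<circ> tr j)\<close> by (auto simp: S_def)
    have ne: "(i, k) \<noteq> (j, Suc j)"
      using p assms(3) by auto
    have "(tr j i, tr j k) \<noteq> (j, Suc j)"
    proof
      assume "(tr j i, tr j k) = (j, Suc j)"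
      then have "i = tr j j" "k = tr j (Suc j)"
        by (metis prod.inject tr_tr)+
      then show False
        using p by simp
    qed
    then show ?thesis
      using ord[OF p(2-4) ne] p by (auto simp: S_def h_def)
  qed
  have sub2: "h p \<in> S (w \<circ> tr j)" if "p \<in> S w - {(j, Suc j)}" for p
  proof -
    obtain i k where p: "p = (i, k)" "1 \<le> i" "i < k" "k \<le> n" "w i < w k" "(i, k) \<noteq> (j, Suc j)"
      using \<open>p \<in> S w - {(j, Suc j)}\<close> by (auto simp: S_def)
    then show ?thesis
      using ord[OF p(2-4,6)] by (simp add: S_def h_def)
  qed
  have "bij_betw h (S (w \<circ> tr j)) (S w - {(j, Suc j)})"
    by (rule bij_betwI[of _ _ _ h]) (use sub1 sub2 hh in auto)
  then have "card (S (w \<circ> tr j)) = card (S w - {(j, Suc j)})"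
    by (rule bij_betw_same_card)
  moreover have "(j, Suc j) \<in> S w"
    using assms by (simp add: S_def)
  ultimately have "card (S w) = Suc (card (S (w \<circ> tr j)))"
    using card_Suc_Diff1[OF fin, of "(j, Suc j)" w] by metis
  then show ?thesis
    by (simp add: ninv_def S_def)
qed

lemma ninv_eq_0_iff: "ninv n w = 0 \<longleftrightarrow> (\<forall>i k. 1 \<le> i \<and> i < k \<and> k \<le> n \<longrightarrow> w k \<le> w i)"
proof -
  have "finite {(i, k). 1 \<le> i \<and> i < k \<and> k \<le> n \<and> w i < w k}"
    by (rule finite_subset[of _ "{1..n} \<times> {1..n}"]) auto
  then show ?thesis
    by (auto simp: ninv_def) (metis linorder_not_less)+
qed

lemma ninv_eq_0_if_no_ascent:
  assumes "\<not> (\<exists>j. 1 \<le> j \<and> j < n \<and> w j < w (Suc j))"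
  shows "ninv n w = 0"
  unfolding ninv_eq_0_iff
proof safe
  fix i k :: nat
  assume "1 \<le> i" "i < k" "k \<le> n"
  then have "Suc i \<le> k"
    by simp
  then show "w k \<le> w i"
    using \<open>k \<le> n\<close>
  proof (induction rule: dec_induct)
    case base
    then show ?case
      using assms \<open>1 \<le> i\<close> by (meson Suc_le_lessD linorder_not_less)
  next
    case (step m)
    then have "w (Suc m) \<le> w m"
      using assms \<open>1 \<le> i\<close> by (metis Suc_le_lessD le_trans less_imp_le linorder_not_less)
    then show ?case
      using step by simp
  qed
qed

text \<open>Induction on the number of non-inversions; \<open>dbar_Phi\<close> holds at every
  ascent, in particular at the least one, which \<open>gro\<close> chooses.\<close>

lemma groth_eq_Phi:
  assumes "w permutes {1..n}"
  shows "groth n w = Phi 1 (n - 1) Xv (inv w)"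
proof -
  have "gro n k w = Phi 1 (n - 1) Xv (inv w)" if "w permutes {1..n}" "ninv n w = k" for k
    using that
  proof (induction k arbitrary: w)
    case 0
    show ?case
    \<comment> \<open>For \<open>n = 0\<close> truncated subtraction breaks
      \<open>1 + (n - 1) = n\<close>.\<close>
    proof (cases "n = 0")
      case True
      then show ?thesis
        using 0 by (simp add: top_poly_def delta_def id_def)
    next
      case False
      then have n: "1 + (n - 1) = n"
        by simp
      have "Phi 1 (n - 1) Xv (inv w) = (\<Prod>r\<in>{1..<1 + (n - 1)}. Xv r ^ (1 + (n - 1) - r))"
      proof (rule Phi_decreasing)
        show "inv w permutes {1..1 + (n - 1)}"
          unfolding n by (rule permutes_inv) fact
        fix a b :: nat
        assume ab: "1 \<le> a" "a < b" "b \<le> 1 + (n - 1)"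
        have w: "w (inv w u) = u" for u
          using 0 by (simp add: permutes_inverses)
        have "inv w a \<in> {1..n}" "inv w b \<in> {1..n}"
          using ab n permutes_in_image[OF permutes_inv[OF 0(1)]] by auto
        moreover have "inv w a \<noteq> inv w b"
          using w ab by (metis less_irrefl)
        moreover have "\<not> inv w a < inv w b"
          using 0(2) ab w calculation unfolding ninv_eq_0_iff
          by (metis atLeastAtMost_iff linorder_not_less)
        ultimately show "inv w b < inv w a"
          by auto
      qed
      then show ?thesis
        using n by (simp add: top_poly_def)
    qed
  next
    case (Suc k)
    define j where "j = (LEAST j. 1 \<le> j \<and> j < n \<and> w j < w (Suc j))"
    have ex: "\<exists>j. 1 \<le> j \<and> j < n \<and> w j < w (Suc j)"
      using ninv_eq_0_if_no_ascent[of n w] Suc.prems by auto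
    then have j: "1 \<le> j" "j < n" "w j < w (Suc j)"
      unfolding j_def by (metis (mono_tags, lifting) LeastI)+
    have bij: "bij w"
      using Suc.prems(1) by (rule permutes_bij)
    have "gro n k (w \<circ> tr j) = Phi 1 (n - 1) Xv (inv (w \<circ> tr j))"
      proof (rule Suc.IH)
      show "w \<circ> tr j permutes {1..n}"
        using Suc.prems(1) j(1,2) by (rule permutes_comp_tr)
      show "ninv n (w \<circ> tr j) = k"
        using Suc.prems(2) ninv_comp_tr[OF j] by (metis Suc_inject)
    qed
    moreover have "gro n (Suc k) w = dbar j (gro n k (w \<circ> tr j))"
      using ex by (simp add: j_def Let_def)
    moreover have "dbar j (Phi 1 (n - 1) Xv (tr j \<circ> inv w)) = Phi 1 (n - 1) Xv (inv w)"
      by (rule dbar_Phi) (use j bij in \<open>auto simp: bij_imp_bij_inv inv_inv_eq\<close>)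
    ultimately show ?case
      by (simp only: inv_comp_tr[OF bij])
  qed
  then show ?thesis
    using assms by (simp add: groth_def)
qed

section \<open>Supports and walks\<close>

lemma absv_superset:
  assumes "finite S" "Poly_Mapping.keys a \<subseteq> S"
  shows "absv a = (\<Sum>i\<in>S. Poly_Mapping.lookup a i)"
  unfolding absv_def using assms by (intro sum.mono_neutral_left) (auto simp: in_keys_iff)

lemma absv_add: "absv (a + b) = absv a + absv b"
proof -
  let ?S = "Poly_Mapping.keys a \<union> Poly_Mapping.keys b"
  have "absv (a + b) = (\<Sum>i\<in>?S. Poly_Mapping.lookup (a + b) i)"
    by (rule absv_superset) (simp_all add: keys_add)
  moreover have "absv a = (\<Sum>i\<in>?S. Poly_Mapping.lookup a i)" "absv b = (\<Sum>i\<in>?S. Poly_Mapping.lookup b i)"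
    by (rule absv_superset; simp)+
  ultimately show ?thesis
    by (simp add: lookup_add sum.distrib)
qed

lemma absv_single [simp]: "absv (Poly_Mapping.single i c) = c"
  by (cases "c = 0") (simp_all add: absv_def)

lemma absv_mono: "comp_le a b \<Longrightarrow> absv a \<le> absv b"
proof -
  assume le: "comp_le a b"
  then have "Poly_Mapping.keys a \<subseteq> Poly_Mapping.keys b"
    unfolding comp_le_def by (metis in_keys_iff le_zero_eq subsetI)
  then have "absv a = (\<Sum>i\<in>Poly_Mapping.keys b. Poly_Mapping.lookup a i)"
    by (intro absv_superset) auto
  then show ?thesis
    using le by (simp add: absv_def comp_le_def sum_mono)
qed

lemma lookup_Xv_times:
  "Poly_Mapping.lookup (Xv i * f) m = (\<Sum>q. Poly_Mapping.lookup f q when m = Poly_Mapping.single i 1 + q)"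
  by (simp only: Xv_def lookup_mult lookup_single when_mult mult_1 Sum_any_when_equal')

lemma lookup_Xv_mult: "Poly_Mapping.lookup (Xv i * f) (Poly_Mapping.single i 1 + m) = Poly_Mapping.lookup f m"
  by (simp add: lookup_Xv_times)

lemma lookup_Xv_mult_0:
  assumes "Poly_Mapping.lookup m i = 0"
  shows "Poly_Mapping.lookup (Xv i * f) m = 0"
proof -
  have "m \<noteq> Poly_Mapping.single i 1 + q" for q
  proof
    assume "m = Poly_Mapping.single i 1 + q"
    then have "Poly_Mapping.lookup m i = Poly_Mapping.lookup (Poly_Mapping.single i 1 + q) i"
      by simp
    then show False
      using assms by (simp add: lookup_add)
  qed
  then show ?thesis
    unfolding lookup_Xv_times by simp
qed

lemma mono_split:
  fixes m :: mono
  assumes "Poly_Mapping.lookup m i \<noteq> 0"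
  obtains m' where "m = Poly_Mapping.single i 1 + m'"
proof
  show "m = Poly_Mapping.single i 1 + (m - Poly_Mapping.single i 1)"
    using assms by (intro poly_mapping_eqI) (auto simp: lookup_add lookup_minus lookup_single when_def)
qed

definition alternating :: "int \<Rightarrow> gpoly \<Rightarrow> bool" where
  "alternating e f \<longleftrightarrow> (\<forall>m. 0 \<le> e * (- 1) ^ absv m * Poly_Mapping.lookup f m)"

text \<open>The opposite sign \<open>- e\<close> at the swapped permutation makes up for the extra
  factor \<open>Xv i\<close>: the contributions \<open>F (x + m')\<close>, \<open>G m'\<close> and
  \<open>- F m'\<close> to one coefficient agree in sign, so nothing cancels.\<close>

lemma supp_hop:
  assumes e: "e = 1 \<or> e = - 1"
    and f: "alternating e (\<phi> \<sigma>)"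
    and g: "alternating (- e) (\<phi> (\<sigma> \<circ> tr a))"
    and desc: "\<sigma> (Suc a) < \<sigma> a"
  shows "alternating e (hop a 1 (Xv i) \<phi> \<sigma>)"
    and "m \<in> supp (hop a 1 (Xv i) \<phi> \<sigma>) \<longleftrightarrow> m \<in> supp (\<phi> \<sigma>) \<or>
      (\<exists>m'. m = Poly_Mapping.single i 1 + m' \<and> (m' \<in> supp (\<phi> \<sigma>) \<or> m' \<in> supp (\<phi> (\<sigma> \<circ> tr a))))"
proof -
  define F where "F = Poly_Mapping.lookup (\<phi> \<sigma>)"
  define G where "G = Poly_Mapping.lookup (\<phi> (\<sigma> \<circ> tr a))"
  define H where "H = Poly_Mapping.lookup (hop a 1 (Xv i) \<phi> \<sigma>)"
  define x where "x = Poly_Mapping.single i (1::nat)"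
  have H0: "H m = F m" if "Poly_Mapping.lookup m i = 0" for m
    using desc that by (simp add: H_def F_def hop_def lookup_add right_diff_distrib lookup_minus lookup_Xv_mult_0)
  have H1: "H (x + m') = F (x + m') + (G m' - F m')" for m'
    using desc by (simp add: H_def F_def G_def x_def hop_def lookup_add right_diff_distrib lookup_minus lookup_Xv_mult[unfolded One_nat_def])
  have Fs: "0 \<le> e * (- 1) ^ absv m * F m" for m
    using f by (simp add: alternating_def F_def)
  have Gs: "0 \<le> - (e * (- 1) ^ absv m * G m)" for m
    using g by (simp add: alternating_def G_def)
  have abs: "absv (x + m') = Suc (absv m')" for m'
    by (simp add: absv_add x_def)
  have unit: "e * (- 1) ^ d = 1 \<or> e * (- 1) ^ d = - 1" for d :: nat
    using e by (cases "even d") auto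
  have *: "0 \<le> e * (- 1) ^ absv (x + m') * H (x + m') \<and>
      (H (x + m') = 0 \<longleftrightarrow> F (x + m') = 0 \<and> F m' = 0 \<and> G m' = 0)" for m'
    using Fs[of "x + m'"] Fs[of m'] Gs[of m'] unit[of "absv m'"] unfolding H1 abs by auto
  have x: "\<exists>m'. m = x + m'" if "Poly_Mapping.lookup m i \<noteq> 0" for m
    using mono_split[OF that] x_def by metis
  show "alternating e (hop a 1 (Xv i) \<phi> \<sigma>)"
    unfolding alternating_def H_def[symmetric]
  proof
    fix m
    show "0 \<le> e * (- 1) ^ absv m * H m"
      using Fs[of m] H0[of m] x[of m] * by (cases "Poly_Mapping.lookup m i = 0") auto
  qed
  have inj: "x + m' = x + m'' \<longleftrightarrow> m' = m''" for m' m''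
    by simp
  have nx: "Poly_Mapping.lookup (x + m') i \<noteq> 0" for m'
    by (simp add: x_def lookup_add)
  have "H m \<noteq> 0 \<longleftrightarrow> F m \<noteq> 0 \<or> (\<exists>m'. m = x + m' \<and> (F m' \<noteq> 0 \<or> G m' \<noteq> 0))"
  proof (cases "Poly_Mapping.lookup m i = 0")
    case True
    then have "m \<noteq> x + m'" for m'
      using nx by metis
    then show ?thesis
      using H0[OF True] by simp
  next
    case False
    then obtain m' where "m = x + m'"
      using x by blast
    then show ?thesis
      using *[of m'] inj by auto
  qed
  then show "m \<in> supp (hop a 1 (Xv i) \<phi> \<sigma>) \<longleftrightarrow> m \<in> supp (\<phi> \<sigma>) \<or>
      (\<exists>m'. m = Poly_Mapping.single i 1 + m' \<and> (m' \<in> supp (\<phi> \<sigma>) \<or> m' \<in> supp (\<phi> (\<sigma> \<circ> tr a))))"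
    by (simp add: supp_def in_keys_iff H_def F_def G_def x_def)
qed

text \<open>\<open>walk i k \<sigma> c \<tau>\<close>: the letters \<open>j = i + k - 1, \<dots>, i\<close> are read in this order, each is skipped or
  used, and \<open>c\<close> letters are used; using a letter may leave the permutation unchanged since
  \<open>u\<^sub>j\<^sup>2 = - u\<^sub>j\<close>.\<close>
primrec walk :: "nat \<Rightarrow> nat \<Rightarrow> (nat \<Rightarrow> nat) \<Rightarrow> nat \<Rightarrow> (nat \<Rightarrow> nat) \<Rightarrow> bool" where
  "walk i 0 \<sigma> c \<tau> \<longleftrightarrow> c = 0 \<and> \<tau> = \<sigma>"
| "walk i (Suc k) \<sigma> c \<tau> \<longleftrightarrow> walk i k \<sigma> c \<tau> \<or>
     \<sigma> (Suc (i + k)) < \<sigma> (i + k) \<and>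
     (\<exists>c'. c = Suc c' \<and> (walk i k \<sigma> c' \<tau> \<or> walk i k (\<sigma> \<circ> tr (i + k)) c' \<tau>))"

lemma tr_transpose: "tr j = transpose j (Suc j)"
  by (auto simp: tr_def transpose_def fun_eq_iff)

lemma permutation_comp_tr: "permutation \<sigma> \<Longrightarrow> permutation (\<sigma> \<circ> tr j)"
  by (simp add: tr_transpose permutation_compose permutation_swap_id)

lemma sign_comp_tr: "permutation \<sigma> \<Longrightarrow> sign (\<sigma> \<circ> tr j) = - sign \<sigma>"
  by (simp add: tr_transpose sign_compose permutation_swap_id sign_swap_id)

text \<open>The sign of the permutation serves as \<open>e\<close> in \<open>supp_hop\<close>, since
  \<open>tr\<close> flips it. The three ways to extend a walk are the three contributions found
  there.\<close>

lemma supp_rowop: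
  assumes "\<And>\<sigma>. permutation \<sigma> \<Longrightarrow> alternating (sign \<sigma>) (\<phi> \<sigma>)" "permutation \<sigma>"
  shows "alternating (sign \<sigma>) (rowop i k (Xv r) \<phi> \<sigma>) \<and>
    (\<forall>m. m \<in> supp (rowop i k (Xv r) \<phi> \<sigma>) \<longleftrightarrow>
      (\<exists>c \<tau> m'. walk i k \<sigma> c \<tau> \<and> m' \<in> supp (\<phi> \<tau>) \<and> m = Poly_Mapping.single r c + m'))"
  using assms(2)
proof (induction k arbitrary: \<sigma>)
  case 0
  then show ?case
    using assms(1) by auto
next
  case (Suc k)
  let ?j = "i + k"
  note IH1 = Suc.IH[OF Suc.prems]
  note IH2 = Suc.IH[OF permutation_comp_tr[OF Suc.prems, of ?j]]
  show ?case
  proof (cases "\<sigma> (Suc ?j) < \<sigma> ?j")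
    case False
    then have "rowop i (Suc k) (Xv r) \<phi> \<sigma> = rowop i k (Xv r) \<phi> \<sigma>"
      by (simp add: hop_def)
    moreover have "walk i (Suc k) \<sigma> c \<tau> \<longleftrightarrow> walk i k \<sigma> c \<tau>" for c \<tau>
      using False by simp
    ultimately show ?thesis
      using IH1 by simp
  next
    case True
    let ?\<psi> = "rowop i k (Xv r) \<phi>"
    have e: "sign \<sigma> = 1 \<or> sign \<sigma> = - 1"
      by (simp add: sign_def)
    have g: "alternating (- sign \<sigma>) (?\<psi> (\<sigma> \<circ> tr ?j))"
      by (rule IH2[THEN conjunct1, unfolded sign_comp_tr[OF Suc.prems]])
    note hop = supp_hop[of "sign \<sigma>" ?\<psi> \<sigma> ?j, OF e IH1[THEN conjunct1] g True]
    have s: "Poly_Mapping.single r (Suc c) + m = Poly_Mapping.single r 1 + (Poly_Mapping.single r c + m)"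
      for c and m :: mono
      by (simp only: single_add[symmetric] add.assoc[symmetric] plus_1_eq_Suc)
    define W where "W k \<sigma> m \<longleftrightarrow>
      (\<exists>c \<tau> m'. walk i k \<sigma> c \<tau> \<and> m' \<in> supp (\<phi> \<tau>) \<and> m = Poly_Mapping.single r c + m')" for k \<sigma> m
    have WI: "W k \<sigma> (Poly_Mapping.single r c + m')" if "walk i k \<sigma> c \<tau>" "m' \<in> supp (\<phi> \<tau>)" for k \<sigma> c \<tau> m'
      unfolding W_def using that by metis
    have step: "W (Suc k) \<sigma> m \<longleftrightarrow> W k \<sigma> m \<or>
      (\<exists>m'. m = Poly_Mapping.single r 1 + m' \<and> (W k \<sigma> m' \<or> W k (\<sigma> \<circ> tr ?j) m'))" for m
    proof
      assume "W (Suc k) \<sigma> m"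
      then obtain c \<tau> m' where w: "walk i (Suc k) \<sigma> c \<tau>" "m' \<in> supp (\<phi> \<tau>)" "m = Poly_Mapping.single r c + m'"
        unfolding W_def by blast
      from w(1) consider "walk i k \<sigma> c \<tau>"
        | c' where "c = Suc c'" "walk i k \<sigma> c' \<tau> \<or> walk i k (\<sigma> \<circ> tr ?j) c' \<tau>"
        by auto
      then show "W k \<sigma> m \<or> (\<exists>m'. m = Poly_Mapping.single r 1 + m' \<and> (W k \<sigma> m' \<or> W k (\<sigma> \<circ> tr ?j) m'))"
      proof cases
        case 1
        then have "W k \<sigma> m"
          unfolding w(3) using w(2) by (rule WI)
        then show ?thesis ..
      next
        case (2 c')
        have "m = Poly_Mapping.single r 1 + (Poly_Mapping.single r c' + m')"
          unfolding w(3) 2(1) by (rule s)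
        moreover have "W k \<sigma> (Poly_Mapping.single r c' + m') \<or> W k (\<sigma> \<circ> tr ?j) (Poly_Mapping.single r c' + m')"
          using 2(2) WI w(2) by metis
        ultimately show ?thesis
          by blast
      qed
    next
      assume "W k \<sigma> m \<or> (\<exists>m'. m = Poly_Mapping.single r 1 + m' \<and> (W k \<sigma> m' \<or> W k (\<sigma> \<circ> tr ?j) m'))"
      then show "W (Suc k) \<sigma> m"
      proof (elim disjE[of "W k \<sigma> m"] exE conjE)
        assume "W k \<sigma> m"
        then show ?thesis
          unfolding W_def walk.simps by metis
      next
        fix m'
        assume m: "m = Poly_Mapping.single r 1 + m'" and "W k \<sigma> m' \<or> W k (\<sigma> \<circ> tr ?j) m'"
        then obtain c \<tau> m'' where w: "walk i k \<sigma> c \<tau> \<or> walk i k (\<sigma> \<circ> tr ?j) c \<tau>"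
          "m'' \<in> supp (\<phi> \<tau>)" "m' = Poly_Mapping.single r c + m''"
          unfolding W_def by blast
        have m_eq: "m = Poly_Mapping.single r (Suc c) + m''"
          unfolding m w(3) s ..
        have "walk i (Suc k) \<sigma> (Suc c) \<tau>"
          using w(1) True by simp
        then show ?thesis
          unfolding m_eq using w(2) by (rule WI)
      qed
    qed
    have "m \<in> supp (hop ?j 1 (Xv r) ?\<psi> \<sigma>) \<longleftrightarrow> W (Suc k) \<sigma> m" for m
      unfolding hop(2) IH1[THEN conjunct2, rule_format, folded W_def]
        IH2[THEN conjunct2, rule_format, folded W_def] step ..
    then show ?thesis
      using hop(1) unfolding W_def rowop.simps by blast
  qed
qed

lemma alternating_Phi: "permutation \<sigma> \<Longrightarrow> alternating (sign \<sigma>) (Phi i k Xv \<sigma>)"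
proof (induction k arbitrary: i \<sigma>)
  case 0
  show ?case
    by (auto simp: alternating_def delta_def lookup_one when_def absv_def)
next
  case (Suc k)
  then show ?case
    unfolding Phi.simps using supp_rowop by blast
qed

lemma supp_Phi_Suc:
  assumes "permutation \<sigma>"
  shows "m \<in> supp (Phi i (Suc k) Xv \<sigma>) \<longleftrightarrow>
    (\<exists>c \<tau> m'. walk i (Suc k) \<sigma> c \<tau> \<and> m' \<in> supp (Phi (Suc i) k Xv \<tau>) \<and> m = Poly_Mapping.single i c + m')"
  unfolding Phi.simps by (rule supp_rowop[OF alternating_Phi assms, THEN conjunct2, rule_format])

lemma walk_permutes:
  "\<lbrakk>walk i k \<sigma> c \<tau>; \<sigma> permutes {i..n}; i + k \<le> n\<rbrakk> \<Longrightarrow> \<tau> permutes {i..n}"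
proof (induction k arbitrary: \<sigma> c)
  case (Suc k)
  then show ?case
    using permutes_comp_tr[of \<sigma> i n "i + k"] by fastforce
qed simp

text \<open>In terms of \<open>w = inv \<sigma>\<close>: the positions in \<open>K\<close> carry left-to-right maxima.\<close>
definition records :: "nat \<Rightarrow> nat \<Rightarrow> (nat \<Rightarrow> nat) \<Rightarrow> nat set \<Rightarrow> bool" where
  "records i n \<sigma> K \<longleftrightarrow> (\<forall>a b. i \<le> a \<and> a < b \<and> b \<le> n \<and> \<sigma> a \<in> K \<longrightarrow> \<sigma> a < \<sigma> b)"

text \<open>The swap makes the pair at \<open>j\<close>, \<open>Suc j\<close> increasing and comes
  from an ordered pair of \<open>\<sigma>\<close> everywhere else.\<close>

lemma records_comp_tr:
  assumes "records i n \<sigma> K" "i \<le> j" "j < n" "\<sigma> (Suc j) < \<sigma> j"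
  shows "records i n (\<sigma> \<circ> tr j) K"
  unfolding records_def
proof safe
  fix a b
  assume ab: "i \<le> a" "a < b" "b \<le> n" "(\<sigma> \<circ> tr j) a \<in> K"
  show "(\<sigma> \<circ> tr j) a < (\<sigma> \<circ> tr j) b"
  proof (cases "a = j \<and> b = Suc j")
    case True
    then show ?thesis using assms by simp
  next
    case False
    then have "i \<le> tr j a \<and> tr j a < tr j b \<and> tr j b \<le> n"
      using ab assms by (auto simp: tr_def)
    then show ?thesis
      using assms(1) ab by (simp add: records_def)
  qed
qed

text \<open>With each letter read, the counted set loses at most one element if the letter is
  skipped and none if it is used. Since it is empty after the last letter, every initial element
  pays for a skipped letter.\<close>

lemma walk_records:
  "\<lbrakk>walk i k \<sigma> c \<tau>; inj \<sigma>; i + k \<le> n; records i n \<sigma> K\<rbrakk> \<Longrightarrow>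
    c + card {a. i \<le> a \<and> a < i + k \<and> \<sigma> a \<in> K \<and> \<sigma> a < \<sigma> (i + k)} \<le> k \<and> records i n \<tau> K"
proof (induction k arbitrary: \<sigma> c)
  case 0
  have "{a. i \<le> a \<and> a < i \<and> \<sigma> a \<in> K \<and> \<sigma> a < \<sigma> i} = {}"
    by auto
  then show ?case
    using 0 by simp
next
  case (Suc k)
  let ?j = "i + k"
  define N where "N \<sigma> k = {a. i \<le> a \<and> a < i + k \<and> \<sigma> a \<in> K \<and> \<sigma> a < \<sigma> (i + k)}" for \<sigma> k
  have fin: "finite (N \<sigma> k)" for \<sigma> k
    unfolding N_def by (rule finite_subset[of _ "{..i + k}"]) auto
  note IH = Suc.IH[folded N_def]
  have inj: "\<sigma> a = \<sigma> b \<longleftrightarrow> a = b" for a b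
    using Suc.prems(2) by (simp add: inj_eq)
  from Suc.prems(1) consider "walk i k \<sigma> c \<tau>"
    | c' where "\<sigma> (Suc ?j) < \<sigma> ?j" "c = Suc c'" "walk i k \<sigma> c' \<tau>"
    | c' where "\<sigma> (Suc ?j) < \<sigma> ?j" "c = Suc c'" "walk i k (\<sigma> \<circ> tr ?j) c' \<tau>"
    by auto
  then have "c + card (N \<sigma> (Suc k)) \<le> Suc k \<and> records i n \<tau> K"
  proof cases
    case 1
    have "N \<sigma> (Suc k) \<subseteq> insert ?j (N \<sigma> k)"
    proof
      fix a
      assume a: "a \<in> N \<sigma> (Suc k)"
      show "a \<in> insert ?j (N \<sigma> k)"
      proof (cases "a = ?j")
        case False
        then have "\<sigma> a < \<sigma> ?j"
          using a Suc.prems(3,4) by (auto simp: N_def records_def)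
        then show ?thesis
          using a False by (auto simp: N_def)
      qed simp
    qed
    then have "card (N \<sigma> (Suc k)) \<le> Suc (card (N \<sigma> k))"
      by (metis card_insert_le_m1 card_mono diff_Suc_1 fin finite_insert le_trans zero_less_Suc le_refl)
    then show ?thesis
      using IH[OF 1] Suc.prems by simp
  next
    case 2
    have "N \<sigma> (Suc k) \<subseteq> N \<sigma> k"
      using 2(1) by (auto simp: N_def less_Suc_eq)
    then have "card (N \<sigma> (Suc k)) \<le> card (N \<sigma> k)"
      by (intro card_mono fin)
    then show ?thesis
      using IH[OF 2(3)] Suc.prems 2(2) by simp
  next
    case 3
    have tr: "tr ?j a = a" if "a < ?j" for a
      using that by simp
    have "N \<sigma> (Suc k) \<subseteq> N (\<sigma> \<circ> tr ?j) k"
      using 3(1) by (auto simp: N_def less_Suc_eq tr)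
    then have "card (N \<sigma> (Suc k)) \<le> card (N (\<sigma> \<circ> tr ?j) k)"
      by (intro card_mono fin)
    moreover have "c' + card (N (\<sigma> \<circ> tr ?j) k) \<le> k \<and> records i n \<tau> K"
    proof (rule IH[OF 3(3)])
      show "inj (\<sigma> \<circ> tr ?j)"
        by (intro inj_compose Suc.prems bij_is_inj bij_tr)
      show "records i n (\<sigma> \<circ> tr ?j) K"
        using Suc.prems 3(1) by (intro records_comp_tr) auto
    qed (use Suc.prems(3) in simp)
    ultimately show ?thesis
      using 3(2) by simp
  qed
  then show ?case
    unfolding N_def .
qed

section \<open>Upper bounds for the exponents\<close>

lemma permutes_interval_permutation: "\<sigma> permutes {i..n::nat} \<Longrightarrow> permutation \<sigma>"
  using permutation_permutes by blast

text \<open>Each exponent counts the letters used in one row, which \<open>walk_records\<close>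
  bounds; the records survive the row and so bound the later exponents too.\<close>

lemma supp_Phi_le:
  assumes "m \<in> supp (Phi i k Xv \<sigma>)" "\<sigma> permutes {i..i + k}" "records i (i + k) \<sigma> K"
  shows "(\<forall>r. i \<le> r \<and> r < i + k \<longrightarrow> Poly_Mapping.lookup m r + card (K \<inter> {r<..i + k}) \<le> i + k - r) \<and>
    (\<forall>r. r < i \<or> i + k \<le> r \<longrightarrow> Poly_Mapping.lookup m r = 0)"
  using assms
proof (induction k arbitrary: i \<sigma> m)
  case 0
  then have "m = 0"
    by (auto simp: supp_def delta_def split: if_splits)
  then show ?case
    by simp
next
  case (Suc k)
  define n where "n = i + Suc k"
  have perm: "\<sigma> permutes {i..n}" and K: "records i n \<sigma> K"
    using Suc.prems by (simp_all add: n_def)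
  obtain c \<tau> m' where w: "walk i (Suc k) \<sigma> c \<tau>"
    and m': "m' \<in> supp (Phi (Suc i) k Xv \<tau>)" and m: "m = Poly_Mapping.single i c + m'"
    using Suc.prems(1) supp_Phi_Suc[OF permutes_interval_permutation[OF perm]] by blast
  have "\<tau> i = i"
    using m' Phi_eq_0[of i "Suc i" \<tau> k Xv] by (cases "\<tau> i = i") (simp_all add: supp_def)
  moreover have "\<tau> permutes {i..n}"
    using walk_permutes[OF w perm] by (simp add: n_def)
  ultimately have \<tau>: "\<tau> permutes {Suc i..Suc i + k}"
    using permutes_Suc by (auto simp: n_def)
  have img: "\<sigma> a \<in> {i..n} \<longleftrightarrow> a \<in> {i..n}" for a
    by (rule permutes_in_image[OF perm])
  have inj: "inj \<sigma>"
    using perm by (rule permutes_inj)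
  \<comment> \<open>The least value \<open>i\<close> is always a record. Counting it offsets the
    record that may sit at \<open>n\<close>, which \<open>Q\<close> leaves out.\<close>
  have Ki: "records i n \<sigma> (insert i K)"
    unfolding records_def
  proof (intro allI impI, elim conjE)
    fix a b
    assume ab: "i \<le> a" "a < b" "b \<le> n" "\<sigma> a \<in> insert i K"
    show "\<sigma> a < \<sigma> b"
    proof (cases "\<sigma> a = i")
      case True
      moreover have "i \<le> \<sigma> b" "\<sigma> b \<noteq> \<sigma> a"
        using ab img[of b] inj_eq[OF inj, of b a] by auto
      ultimately show ?thesis
        by simp
    next
      case False
      then show ?thesis
        using ab K by (auto simp: records_def)
    qed
  qed
  define Q where "Q = {a. i \<le> a \<and> a < n \<and> \<sigma> a \<in> insert i K \<and> \<sigma> a < \<sigma> n}"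
  have finQ: "finite Q"
    unfolding Q_def by (rule finite_subset[of _ "{..n}"]) auto
  have walk: "c + card Q \<le> Suc k" "records i n \<tau> (insert i K)"
    using walk_records[OF w inj _ Ki] by (simp_all add: n_def Q_def)
  have "insert i (K \<inter> {i<..n}) \<subseteq> insert (\<sigma> n) (\<sigma> ` Q)"
  proof
    fix p
    assume p: "p \<in> insert i (K \<inter> {i<..n})"
    then have "p \<in> {i..n}"
      by (auto simp: n_def)
    then obtain a where a: "a \<in> {i..n}" "p = \<sigma> a"
      using permutes_image[OF perm] by blast
    show "p \<in> insert (\<sigma> n) (\<sigma> ` Q)"
    proof (cases "a = n")
      case False
      then have "\<sigma> a < \<sigma> n"
        using a p Ki by (auto simp: records_def)
      then have "a \<in> Q"
        using a p False by (auto simp: Q_def)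
      then show ?thesis
        using a by blast
    qed (use a in simp)
  qed
  then have "card (insert i (K \<inter> {i<..n})) \<le> card (insert (\<sigma> n) (\<sigma> ` Q))"
    using finQ by (intro card_mono) auto
  also have "\<dots> \<le> Suc (card Q)"
    using finQ card_insert_if[of "\<sigma> ` Q" "\<sigma> n"] card_image_le[OF finQ, of \<sigma>] by simp
  finally have Q: "card (K \<inter> {i<..n}) \<le> card Q"
    by simp
  have "records (Suc i) (Suc i + k) \<tau> K"
    using walk(2) by (auto simp: records_def n_def)
  note IH = Suc.IH[OF m' \<tau> this]
  have "Poly_Mapping.lookup m r + card (K \<inter> {r<..n}) \<le> n - r" if "i \<le> r" "r < n" for r
  proof (cases "r = i")
    case True
    then show ?thesis
      using IH walk(1) Q by (simp add: m lookup_add n_def)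
  next
    case False
    then show ?thesis
      using IH that by (simp add: m lookup_add n_def lookup_single_not_eq)
  qed
  moreover have "Poly_Mapping.lookup m r = 0" if "r < i \<or> n \<le> r" for r
    using IH that by (auto simp: m lookup_add n_def lookup_single when_def)
  ultimately show ?case
    by (simp add: n_def)
qed

section \<open>Fireworks permutations\<close>

text \<open>With \<open>w = inv \<sigma>\<close> these are the positions \<open>p\<close> with
  \<open>w p < w (Suc p)\<close>; their successors are the run starts other than the first
  position.\<close>

definition ascents :: "nat \<Rightarrow> nat \<Rightarrow> (nat \<Rightarrow> nat) \<Rightarrow> nat set" where
  "ascents i n \<sigma> = {p. \<exists>a b. i \<le> a \<and> a < b \<and> b \<le> n \<and> \<sigma> a = p \<and> \<sigma> b = Suc p}"

definition inv_fireworks :: "nat \<Rightarrow> nat \<Rightarrow> (nat \<Rightarrow> nat) \<Rightarrow> bool" where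
  "inv_fireworks i n \<sigma> \<longleftrightarrow> records i n \<sigma> (Suc ` ascents i n \<sigma>)"

text \<open>For \<open>w = inv \<sigma>\<close> the right-hand side is avoidance of the pattern 3-12
  whose last two letters are adjacent in \<open>w\<close>.\<close>

lemma inv_fireworks_iff:
  assumes "inj \<sigma>"
  shows "inv_fireworks i n \<sigma> \<longleftrightarrow>
    (\<forall>a b c. i \<le> a \<and> a < b \<and> b < c \<and> c \<le> n \<and> \<sigma> b = Suc (\<sigma> a) \<longrightarrow> \<sigma> b < \<sigma> c)"
proof
  assume fw: "inv_fireworks i n \<sigma>"
  show "\<forall>a b c. i \<le> a \<and> a < b \<and> b < c \<and> c \<le> n \<and> \<sigma> b = Suc (\<sigma> a) \<longrightarrow> \<sigma> b < \<sigma> c"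
  proof (intro allI impI, elim conjE)
    fix a b c
    assume abc: "i \<le> a" "a < b" "b < c" "c \<le> n" "\<sigma> b = Suc (\<sigma> a)"
    then have "b \<le> n"
      by simp
    then have "\<sigma> a \<in> ascents i n \<sigma>"
      unfolding ascents_def using abc by blast
    then have "\<sigma> b \<in> Suc ` ascents i n \<sigma>"
      using abc by simp
    then show "\<sigma> b < \<sigma> c"
      using fw abc unfolding inv_fireworks_def records_def by (meson le_trans less_imp_le)
  qed
next
  assume *: "\<forall>a b c. i \<le> a \<and> a < b \<and> b < c \<and> c \<le> n \<and> \<sigma> b = Suc (\<sigma> a) \<longrightarrow> \<sigma> b < \<sigma> c"
  show "inv_fireworks i n \<sigma>"
    unfolding inv_fireworks_def records_def
  proof safe
    fix x c p
    assume "i \<le> x" "x < c" "c \<le> n" "\<sigma> x = Suc p" "p \<in> ascents i n \<sigma>"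
    moreover from this obtain a b where "i \<le> a" "a < b" "b \<le> n" "\<sigma> a = p" "\<sigma> b = Suc p"
      by (auto simp: ascents_def)
    moreover from calculation have "b = x"
      using injD[OF assms, of b x] by simp
    ultimately show "\<sigma> x < \<sigma> c"
      using * by metis
  qed
qed

text \<open>Swapping the values \<open>j\<close> and \<open>Suc j\<close> of
  \<open>w = inv \<sigma>\<close> affects a comparison of neighbouring entries only if these two are
  neighbours themselves. That is excluded unless they start at position \<open>i\<close>, which
  \<open>{i<..}\<close> leaves out.\<close>

lemma ascents_comp_tr:
  assumes "i \<le> j" "j < n" "\<sigma> (Suc j) < \<sigma> j" "\<sigma> j \<noteq> Suc (\<sigma> (Suc j)) \<or> \<sigma> (Suc j) = i"
  shows "ascents i n (\<sigma> \<circ> tr j) \<inter> {i<..} = ascents i n \<sigma> \<inter> {i<..}"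
proof -
  have tr: "i \<le> tr j a \<and> tr j a < tr j b \<and> tr j b \<le> n"
    if "i \<le> a" "a < b" "b \<le> n" "\<not> (a = j \<and> b = Suc j)" for a b
    using that assms(1,2) by (auto simp: tr_def)
  have "p \<in> ascents i n \<sigma>" if p: "p \<in> ascents i n (\<sigma> \<circ> tr j)" "i < p" for p
  proof -
    obtain a b where ab: "i \<le> a" "a < b" "b \<le> n" "\<sigma> (tr j a) = p" "\<sigma> (tr j b) = Suc p"
      using p(1) by (auto simp: ascents_def)
    then have "\<not> (a = j \<and> b = Suc j)"
      using assms(4) p(2) by auto
    then show ?thesis
      using tr[OF ab(1-3)] ab(4,5) by (auto simp: ascents_def)
  qed
  moreover have "p \<in> ascents i n (\<sigma> \<circ> tr j)" if p: "p \<in> ascents i n \<sigma>" for p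
  proof -
    obtain a b where ab: "i \<le> a" "a < b" "b \<le> n" "\<sigma> a = p" "\<sigma> b = Suc p"
      using p by (auto simp: ascents_def)
    then have "\<not> (a = j \<and> b = Suc j)"
      using assms(3) by auto
    moreover have "(\<sigma> \<circ> tr j) (tr j a) = p" "(\<sigma> \<circ> tr j) (tr j b) = Suc p"
      using ab by simp_all
    ultimately show ?thesis
      using tr[OF ab(1-3)] unfolding ascents_def by blast
  qed
  ultimately show ?thesis
    by auto
qed

text \<open>The only possible new ascent is at position \<open>i\<close>. Its run start
  \<open>Suc i\<close> is a record because only position \<open>i\<close> precedes it, with a
  smaller entry.\<close>

lemma inv_fireworks_comp_tr:
  assumes "inj \<sigma>" "\<And>a. i \<le> a \<Longrightarrow> i \<le> \<sigma> a" "inv_fireworks i n \<sigma>" "i \<le> j" "j < n"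
    and "\<sigma> (Suc j) < \<sigma> j" "\<sigma> j \<noteq> Suc (\<sigma> (Suc j)) \<or> \<sigma> (Suc j) = i"
  shows "inv_fireworks i n (\<sigma> \<circ> tr j)"
proof -
  have inj: "inj (\<sigma> \<circ> tr j)"
    by (intro inj_compose assms bij_is_inj bij_tr)
  show ?thesis
    unfolding inv_fireworks_iff[OF inj]
  proof (intro allI impI, elim conjE)
    fix a b c
    assume h: "i \<le> a" "a < b" "b < c" "c \<le> n" "(\<sigma> \<circ> tr j) b = Suc ((\<sigma> \<circ> tr j) a)"
    note F = assms(3)[unfolded inv_fireworks_iff[OF assms(1)], rule_format]
    show "(\<sigma> \<circ> tr j) b < (\<sigma> \<circ> tr j) c"
    proof (cases "a = j \<and> b = Suc j")
      case True
      then have "\<sigma> (Suc j) = i" "tr j c = c"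
        using h assms(6,7) by auto
      moreover have "\<sigma> c \<noteq> \<sigma> j" "\<sigma> c \<noteq> \<sigma> (Suc j)"
        unfolding inj_eq[OF assms(1)] using True h by auto
      moreover have "i \<le> \<sigma> c"
        using h by (intro assms(2)) auto
      ultimately show ?thesis
        using True h by auto
    next
      case False
      then have ab: "i \<le> tr j a" "tr j a < tr j b"
        using h assms(4,5) by (auto simp: tr_def)
      show ?thesis
      proof (cases "b = j \<and> c = Suc j")
        case True
        then show ?thesis
          using assms(6) by simp
      next
        case False
        then have "tr j b < tr j c" "tr j c \<le> n"
          using h assms(4,5) by (auto simp: tr_def)
        then show ?thesis
          using F[of "tr j a" "tr j b" "tr j c"] ab h by simp
      qed
    qed
  qed
qed

text \<open>The greedy walk: a letter \<open>j\<close> is skipped only if it has to be, i.e. if \<open>\<sigma> j < \<sigma> (Suc j)\<close>, and it is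
  used without changing \<open>\<sigma>\<close> only if swapping would destroy a descent at a position other than
  \<open>i\<close>. The skipped letters are left-to-right maxima.\<close>
lemma walk_exists:
  assumes "\<sigma> permutes {i..n}" "i + k \<le> n" "inv_fireworks i n \<sigma>"
    and "\<And>a b. \<lbrakk>i \<le> a; a < i + k; \<sigma> a < \<sigma> (i + k); i \<le> b; b \<le> n; \<sigma> b < \<sigma> a\<rbrakk> \<Longrightarrow> b < i + k"
    and "\<exists>a. i \<le> a \<and> a \<le> i + k \<and> \<sigma> a = i"
  shows "\<exists>c \<tau>. walk i k \<sigma> c \<tau> \<and> \<tau> i = i \<and> inv_fireworks i n \<tau> \<and>
    ascents i n \<tau> \<inter> {i<..} = ascents i n \<sigma> \<inter> {i<..} \<and>
    k \<le> c + card {a. i \<le> a \<and> a < i + k \<and> \<sigma> a < \<sigma> (i + k) \<and>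
      (\<forall>b. i \<le> b \<and> b \<le> n \<and> \<sigma> b < \<sigma> a \<longrightarrow> b < a)}"
  using assms
proof (induction k arbitrary: \<sigma>)
  case 0
  then show ?case
    by auto
next
  case (Suc k)
  let ?j = "i + k"
  define L where "L \<sigma> k = {a. i \<le> a \<and> a < i + k \<and> \<sigma> a < \<sigma> (i + k) \<and>
      (\<forall>b. i \<le> b \<and> b \<le> n \<and> \<sigma> b < \<sigma> a \<longrightarrow> b < a)}" for \<sigma> :: "nat \<Rightarrow> nat" and k
  have fin: "finite (L \<sigma> k)" for \<sigma> k
    unfolding L_def by (rule finite_subset[of _ "{..i + k}"]) auto
  note IH = Suc.IH[folded L_def]
  \<comment> \<open>The invariant of the walk; in the skip case it shows that \<open>i + k\<close>
    is a left-to-right maximum.\<close>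
  note I2 = Suc.prems(4)
  have jn: "?j < n"
    using Suc.prems(2) by simp
  have inj: "\<sigma> a = \<sigma> b \<longleftrightarrow> a = b" for a b
    using permutes_inj[OF Suc.prems(1)] by (simp add: inj_eq)
  have ge: "i \<le> \<sigma> a" if "i \<le> a" for a
    using that permutes_in_image[OF Suc.prems(1), of a] permutes_not_in[OF Suc.prems(1), of a]
    by (cases "a \<in> {i..n}") auto
  obtain a0 where a0: "i \<le> a0" "a0 \<le> Suc ?j" "\<sigma> a0 = i"
    using Suc.prems(5) by auto
  have "\<exists>c \<tau>. walk i (Suc k) \<sigma> c \<tau> \<and> \<tau> i = i \<and> inv_fireworks i n \<tau> \<and>
    ascents i n \<tau> \<inter> {i<..} = ascents i n \<sigma> \<inter> {i<..} \<and> Suc k \<le> c + card (L \<sigma> (Suc k))"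
  proof -
    \<comment> \<open>If \<open>\<sigma> (Suc ?j) = i\<close>, the swap is forced even when it
      destroys a descent, as the value \<open>i\<close> must reach position
      \<open>i\<close>.\<close>
    consider (skip) "\<sigma> ?j < \<sigma> (Suc ?j)"
      | (stay) "\<sigma> ?j = Suc (\<sigma> (Suc ?j))" "\<sigma> (Suc ?j) \<noteq> i"
      | (swap) "\<sigma> (Suc ?j) < \<sigma> ?j" "\<sigma> ?j \<noteq> Suc (\<sigma> (Suc ?j)) \<or> \<sigma> (Suc ?j) = i"
      using inj[of ?j "Suc ?j"] by (metis linorder_neqE_nat n_not_Suc_n)
    then show ?thesis
    proof cases
      case skip
      have I2': "b < ?j" if "i \<le> b" "b \<le> n" "\<sigma> b < \<sigma> ?j" for b
        using I2[of ?j b] skip that by (auto simp: less_Suc_eq)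
      have "a0 \<noteq> Suc ?j"
        using skip a0 ge[of ?j] by auto
      then have "\<exists>a\<ge>i. a \<le> ?j \<and> \<sigma> a = i"
        using a0 by (auto simp: le_Suc_eq)
      moreover have "b < ?j" if "i \<le> a" "a < ?j" "\<sigma> a < \<sigma> ?j" "i \<le> b" "b \<le> n" "\<sigma> b < \<sigma> a" for a b
        using I2' that by simp
      ultimately obtain c \<tau> where IHw: "walk i k \<sigma> c \<tau>" "\<tau> i = i" "inv_fireworks i n \<tau>"
        "ascents i n \<tau> \<inter> {i<..} = ascents i n \<sigma> \<inter> {i<..}" "k \<le> c + card (L \<sigma> k)"
        using IH[OF Suc.prems(1) less_imp_le[OF jn] Suc.prems(3)] by blast
      have "insert ?j (L \<sigma> k) \<subseteq> L \<sigma> (Suc k)"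
        using skip I2' by (auto simp: L_def)
      then have "card (insert ?j (L \<sigma> k)) \<le> card (L \<sigma> (Suc k))"
        by (intro card_mono fin)
      moreover have "?j \<notin> L \<sigma> k"
        by (simp add: L_def)
      ultimately have "Suc k \<le> c + card (L \<sigma> (Suc k))"
        using IHw(5) fin by simp
      then show ?thesis
        using IHw by auto
    next
      case stay
      \<comment> \<open>No value lies strictly between \<open>\<sigma> (Suc ?j)\<close> and
        \<open>\<sigma> ?j\<close>, so no counted element is lost.\<close>
      have less: "\<sigma> a < \<sigma> (Suc ?j)" if "\<sigma> a < \<sigma> ?j" "a < ?j" for a
        using that stay(1) inj[of a "Suc ?j"] by simp
      have "b < ?j" if "i \<le> a" "a < ?j" "\<sigma> a < \<sigma> ?j" "i \<le> b" "b \<le> n" "\<sigma> b < \<sigma> a" for a b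
        using I2[of a b] less[of a] that by (auto simp: less_Suc_eq)
      moreover have "a0 \<noteq> Suc ?j"
        using stay a0 by auto
      then have "\<exists>a\<ge>i. a \<le> ?j \<and> \<sigma> a = i"
        using a0 by (auto simp: le_Suc_eq)
      ultimately obtain c \<tau> where IHw: "walk i k \<sigma> c \<tau>" "\<tau> i = i" "inv_fireworks i n \<tau>"
        "ascents i n \<tau> \<inter> {i<..} = ascents i n \<sigma> \<inter> {i<..}" "k \<le> c + card (L \<sigma> k)"
        using IH[OF Suc.prems(1) less_imp_le[OF jn] Suc.prems(3)] by blast
      have "L \<sigma> k \<subseteq> L \<sigma> (Suc k)"
        using less by (auto simp: L_def)
      then have "card (L \<sigma> k) \<le> card (L \<sigma> (Suc k))"
        by (intro card_mono fin)
      then have "Suc k \<le> Suc c + card (L \<sigma> (Suc k))"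
        using IHw(5) by simp
      moreover have "walk i (Suc k) \<sigma> (Suc c) \<tau>"
        using IHw(1) stay(1) by simp
      ultimately show ?thesis
        using IHw(2-4) by blast
    next
      case swap
      let ?\<sigma> = "\<sigma> \<circ> tr ?j"
      have tr: "?\<sigma> a = \<sigma> a" if "a < ?j" for a
        using that by simp
      have perm: "?\<sigma> permutes {i..n}"
        using Suc.prems(1) jn by (intro permutes_comp_tr) auto
      have fw: "inv_fireworks i n ?\<sigma>"
        using Suc.prems(1,3) jn swap ge by (intro inv_fireworks_comp_tr permutes_inj) auto
      have I2': "b < ?j" if ab: "i \<le> a" "a < ?j" "?\<sigma> a < ?\<sigma> ?j" "i \<le> b" "b \<le> n" "?\<sigma> b < ?\<sigma> a" for a b
      proof -
        have "\<sigma> a < \<sigma> (Suc ?j)"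
          using ab by simp
        moreover have "b \<noteq> ?j"
          using ab by auto
        moreover have "b \<noteq> Suc ?j"
          using ab swap(1) by auto
        ultimately show ?thesis
          using I2[of a b] ab by (auto simp: less_Suc_eq)
      qed
      have I3: "\<exists>a\<ge>i. a \<le> ?j \<and> ?\<sigma> a = i"
      proof (cases "a0 = Suc ?j")
        case True
        then show ?thesis using a0 by (intro exI[of _ ?j]) simp
      next
        case False
        moreover have "a0 \<noteq> ?j"
          using swap(1) a0 ge[of "Suc ?j"] by auto
        ultimately show ?thesis using a0 by (intro exI[of _ a0]) simp
      qed
      obtain c \<tau> where IHw: "walk i k ?\<sigma> c \<tau>" "\<tau> i = i" "inv_fireworks i n \<tau>"
        "ascents i n \<tau> \<inter> {i<..} = ascents i n ?\<sigma> \<inter> {i<..}" "k \<le> c + card (L ?\<sigma> k)"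
        using IH[of "\<sigma> \<circ> tr ?j", OF perm less_imp_le[OF jn] fw] I2' I3 by blast
      have "L ?\<sigma> k \<subseteq> L \<sigma> (Suc k)"
      proof
        fix a
        assume a: "a \<in> L ?\<sigma> k"
        then have a': "i \<le> a" "a < ?j" "\<sigma> a < \<sigma> (Suc ?j)"
          by (auto simp: L_def)
        have "b < a" if "i \<le> b" "b \<le> n" "\<sigma> b < \<sigma> a" for b
        proof -
          have "b \<noteq> ?j" "b \<noteq> Suc ?j"
            using that a' swap(1) by auto
          then have "?\<sigma> b = \<sigma> b"
            by simp
          then show ?thesis
            using a that a' by (simp add: L_def)
        qed
        then show "a \<in> L \<sigma> (Suc k)"
          using a' by (auto simp: L_def)
      qed
      then have "card (L ?\<sigma> k) \<le> card (L \<sigma> (Suc k))"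
        by (intro card_mono fin)
      then have "Suc k \<le> Suc c + card (L \<sigma> (Suc k))"
        using IHw(5) by simp
      moreover have "walk i (Suc k) \<sigma> (Suc c) \<tau>"
        using IHw(1) swap(1) by simp
      moreover have "ascents i n ?\<sigma> \<inter> {i<..} = ascents i n \<sigma> \<inter> {i<..}"
        using jn swap by (intro ascents_comp_tr) auto
      ultimately show ?thesis
        using IHw(2-4) by blast
    qed
  qed
  then show ?case
    unfolding L_def .
qed

section \<open>Lower bounds for the exponents and the greatest monomial\<close>

lemma ascents_subset: "ascents i n \<sigma> \<subseteq> \<sigma> ` {i..n}"
  unfolding ascents_def by force

text \<open>A left-to-right maximum after position \<open>i\<close> exceeds its left neighbour and
  hence gives an ascent.\<close>

lemma card_records_le_ascents:
  assumes "\<sigma> permutes {i..n}" "i \<le> n"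
  shows "card {a. i \<le> a \<and> a < n \<and> \<sigma> a < \<sigma> n \<and> (\<forall>b. i \<le> b \<and> b \<le> n \<and> \<sigma> b < \<sigma> a \<longrightarrow> b < a)}
    \<le> card (ascents i n \<sigma>)"
proof -
  let ?L = "{a. i \<le> a \<and> a < n \<and> \<sigma> a < \<sigma> n \<and> (\<forall>b. i \<le> b \<and> b \<le> n \<and> \<sigma> b < \<sigma> a \<longrightarrow> b < a)}"
  have inj: "inj \<sigma>"
    using assms(1) by (rule permutes_inj)
  have finL: "finite ?L"
    by (rule finite_subset[of _ "{..n}"]) auto
  have finA: "finite (ascents i n \<sigma>)"
    by (rule finite_subset[OF ascents_subset]) simp
  \<comment> \<open>The largest value \<open>n\<close> is one more left-to-right maximum; it makes
    up for position \<open>i\<close>, which has no left neighbour.\<close>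
  have "\<sigma> ` insert n ?L - {i} \<subseteq> Suc ` ascents i n \<sigma>"
  proof
    fix p
    assume "p \<in> \<sigma> ` insert n ?L - {i}"
    then obtain a where a: "p = \<sigma> a" "a \<in> insert n ?L" "\<sigma> a \<noteq> i"
      by blast
    then have ain: "a \<in> {i..n}"
      using assms(2) by auto
    then have "\<sigma> a \<in> {i..n}"
      using permutes_in_image[OF assms(1)] by blast
    then have "\<sigma> a - 1 \<in> {i..n}" and pos: "Suc (\<sigma> a - 1) = \<sigma> a"
      using a(3) by auto
    then obtain b where b: "b \<in> {i..n}" "\<sigma> b = \<sigma> a - 1"
      using permutes_image[OF assms(1)] by (metis imageE)
    have "\<sigma> b < \<sigma> a"
      using b pos by simp
    then have "b < a"
      using a(2) b(1) by (cases "b = n") auto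
    then have "\<sigma> a - 1 \<in> ascents i n \<sigma>"
      unfolding ascents_def using ain b pos by auto
    then show "p \<in> Suc ` ascents i n \<sigma>"
      using a(1) pos by (metis imageI)
  qed
  then have "card (\<sigma> ` insert n ?L - {i}) \<le> card (Suc ` ascents i n \<sigma>)"
    using finA by (intro card_mono) auto
  moreover have "card (Suc ` ascents i n \<sigma>) = card (ascents i n \<sigma>)"
    by (simp add: card_image)
  moreover have "card (\<sigma> ` insert n ?L) = Suc (card ?L)"
    using finL by (subst card_image[OF inj_on_subset[OF inj]]) simp_all
  moreover have "card (\<sigma> ` insert n ?L) - 1 \<le> card (\<sigma> ` insert n ?L - {i})"
    using diff_card_le_card_Diff[of "{i}" "\<sigma> ` insert n ?L"] by simp
  ultimately show ?thesis
    by simp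
qed

text \<open>The greedy walk is taken in every row. It preserves \<open>inv_fireworks\<close> and the
  ascents beyond \<open>i\<close>, so the next row can be treated alike.\<close>

lemma supp_Phi_ge:
  assumes "\<sigma> permutes {i..i + k}" "inv_fireworks i (i + k) \<sigma>"
  shows "\<exists>m\<in>supp (Phi i k Xv \<sigma>). \<forall>r. i \<le> r \<and> r < i + k \<longrightarrow>
    i + k - r \<le> Poly_Mapping.lookup m r + card (ascents i (i + k) \<sigma> \<inter> {r..})"
  using assms
proof (induction k arbitrary: i \<sigma>)
  case 0
  then have "\<sigma> = id"
    by (simp add: id_def)
  then show ?case
    by (auto simp: supp_def delta_def)
next
  case (Suc k)
  define n where "n = i + Suc k"
  have perm: "\<sigma> permutes {i..n}" and fw: "inv_fireworks i n \<sigma>"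
    using Suc.prems by (simp_all add: n_def)
  have img: "\<sigma> a \<in> {i..n} \<longleftrightarrow> a \<in> {i..n}" for a
    by (rule permutes_in_image[OF perm])
  let ?L = "{a. i \<le> a \<and> a < n \<and> \<sigma> a < \<sigma> n \<and> (\<forall>b. i \<le> b \<and> b \<le> n \<and> \<sigma> b < \<sigma> a \<longrightarrow> b < a)}"
  have "i \<in> \<sigma> ` {i..n}"
    unfolding permutes_image[OF perm] by (simp add: n_def)
  then have "\<exists>a. i \<le> a \<and> a \<le> i + Suc k \<and> \<sigma> a = i"
    by (auto simp: n_def)
  moreover have "b < i + Suc k" if "b \<le> n" "\<sigma> b < \<sigma> a" "\<sigma> a < \<sigma> (i + Suc k)" for a b
    using that by (cases "b = n") (auto simp: n_def)
  ultimately obtain c \<tau> where w: "walk i (Suc k) \<sigma> c \<tau>" "\<tau> i = i" "inv_fireworks i n \<tau>"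
    "ascents i n \<tau> \<inter> {i<..} = ascents i n \<sigma> \<inter> {i<..}" "Suc k \<le> c + card ?L"
    using walk_exists[OF perm _ fw, of "Suc k"] unfolding n_def by blast
  have perm\<tau>: "\<tau> permutes {i..n}"
    using walk_permutes[OF w(1) perm] by (simp add: n_def)
  then have \<tau>: "\<tau> permutes {Suc i..Suc i + k}"
    using permutes_Suc w(2) by (auto simp: n_def)
  \<comment> \<open>As \<open>\<tau> i = i\<close>, passing to \<open>Suc i\<close> can lose only an
    ascent at position \<open>i\<close>.\<close>
  have asc: "ascents (Suc i) n \<tau> = ascents i n \<tau> \<inter> {i<..}"
  proof -
    have "i < \<tau> a" if "Suc i \<le> a" "a \<le> n" for a
      using permutes_in_image[OF \<tau>, of a] that by (simp add: n_def Suc_le_eq)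
    moreover have "a \<noteq> i" if "i < \<tau> a" for a
      using that w(2) by auto
    ultimately show ?thesis
      unfolding ascents_def by (auto simp: Suc_le_eq) (metis le_neq_implies_less less_imp_le_nat less_le_trans)+
  qed
  have "inv_fireworks (Suc i) (Suc i + k) \<tau>"
    using w(3) unfolding inv_fireworks_iff[OF permutes_inj[OF perm\<tau>]] n_def add_Suc add_Suc_right
    by (meson Suc_leD)
  from Suc.IH[OF \<tau> this] obtain m' where m': "m' \<in> supp (Phi (Suc i) k Xv \<tau>)"
    "\<And>r. Suc i \<le> r \<Longrightarrow> r < n \<Longrightarrow> n - r \<le> Poly_Mapping.lookup m' r + card (ascents (Suc i) n \<tau> \<inter> {r..})"
    by (auto simp: n_def)
  define m where "m = Poly_Mapping.single i c + m'"
  have "m \<in> supp (Phi i (Suc k) Xv \<sigma>)"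
    using supp_Phi_Suc[OF permutes_interval_permutation[OF perm]] w(1) m'(1) m_def by blast
  moreover have "n - r \<le> Poly_Mapping.lookup m r + card (ascents i n \<sigma> \<inter> {r..})" if r: "i \<le> r" "r < n" for r
  proof (cases "r = i")
    case True
    have "ascents i n \<sigma> \<inter> {i..} = ascents i n \<sigma>"
      using ascents_subset[of i n \<sigma>] permutes_image[OF perm] by auto
    moreover have "card ?L \<le> card (ascents i n \<sigma>)"
      by (rule card_records_le_ascents[OF perm]) (simp add: n_def)
    ultimately show ?thesis
      using True w(5) by (simp add: m_def lookup_add n_def)
  next
    case False
    then have "ascents i n \<sigma> \<inter> {r..} = ascents i n \<sigma> \<inter> {i<..} \<inter> {r..}"
      using r by auto
    then have "ascents i n \<sigma> \<inter> {r..} = ascents (Suc i) n \<tau> \<inter> {r..}"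
      using asc w(4) by simp
    then show ?thesis
      using m'(2)[of r] r False by (simp add: m_def lookup_add)
  qed
  ultimately show ?case
    unfolding n_def by blast
qed

text \<open>Upper and lower bounds meet: a run start \<open>Suc p\<close> lies after
  \<open>r\<close> exactly if the ascent \<open>p\<close> is at least \<open>r\<close>.\<close>

lemma supp_Phi_greatest:
  assumes "\<sigma> permutes {i..i + k}" "inv_fireworks i (i + k) \<sigma>"
  shows "\<exists>m\<in>supp (Phi i k Xv \<sigma>). \<forall>m'\<in>supp (Phi i k Xv \<sigma>). comp_le m' m"
proof -
  let ?n = "i + k"
  let ?A = "ascents i ?n \<sigma>"
  obtain m where m: "m \<in> supp (Phi i k Xv \<sigma>)"
    "\<And>r. i \<le> r \<Longrightarrow> r < ?n \<Longrightarrow> ?n - r \<le> Poly_Mapping.lookup m r + card (?A \<inter> {r..})"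
    using supp_Phi_ge[OF assms] by blast
  have "comp_le m' m" if m': "m' \<in> supp (Phi i k Xv \<sigma>)" for m'
    unfolding comp_le_def
  proof
    fix r
    note le = supp_Phi_le[OF m' assms(1) assms(2)[unfolded inv_fireworks_def]]
    show "Poly_Mapping.lookup m' r \<le> Poly_Mapping.lookup m r"
    proof (cases "i \<le> r \<and> r < ?n")
      case True
      have "p < ?n" if p: "p \<in> ?A" for p
      proof -
        obtain a b where "i \<le> a" "a < b" "b \<le> ?n" "\<sigma> b = Suc p"
          using p by (auto simp: ascents_def)
        then show ?thesis
          using permutes_in_image[OF assms(1), of b] by simp
      qed
      then have "Suc ` ?A \<inter> {r<..?n} = Suc ` (?A \<inter> {r..})"
        by (auto simp: Suc_le_eq)
      then have "card (Suc ` ?A \<inter> {r<..?n}) = card (?A \<inter> {r..})"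
        by (simp add: card_image)
      then show ?thesis
        using le[THEN conjunct1, rule_format, OF True] m(2)[of r] True by linarith
    next
      case False
      then show ?thesis
        using le by auto
    qed
  qed
  then show ?thesis
    using m(1) by blast
qed

section \<open>Translation of the fireworks condition and conclusion\<close>

lemma run_start_below:
  assumes "1 \<le> q"
  shows "\<exists>s. 1 \<le> s \<and> s \<le> q \<and> run_start w s \<and> w q \<le> w s"
  using assms
proof (induction q rule: dec_induct)
  case base
  then show ?case
    by (auto simp: run_start_def)
next
  case (step q)
  show ?case
  proof (cases "run_start w (Suc q)")
    case True
    then show ?thesis by auto
  next
    case False
    then have "w (Suc q) \<le> w q"
      by (simp add: run_start_def)
    then show ?thesis
      using step.IH by (meson le_Suc_eq le_trans)
  qed
qed

text \<open>If \<open>c\<close> stood to the left of \<open>b\<close>, its run would start with a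
  value at least \<open>c > b\<close>, while \<open>b\<close> itself starts a later run.\<close>

lemma fireworks_imp_inv_fireworks:
  assumes "w permutes {1..n}" "fireworks n w"
  shows "inv_fireworks 1 n (inv w)"
  unfolding inv_fireworks_iff[OF permutes_inj[OF permutes_inv[OF assms(1)]]]
proof (intro allI impI, elim conjE)
  fix a b c
  assume abc: "1 \<le> a" "a < b" "b < c" "c \<le> n" "inv w b = Suc (inv w a)"
  have w: "w (inv w x) = x" for x
    using assms(1) by (simp add: permutes_inverses)
  have img: "inv w x \<in> {1..n} \<longleftrightarrow> x \<in> {1..n}" for x
    by (rule permutes_in_image[OF permutes_inv[OF assms(1)]])
  have start: "run_start w (inv w b)"
    using w[of a] w[of b] abc by (simp add: run_start_def)
  show "inv w b < inv w c"
  proof (rule ccontr)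
    assume "\<not> inv w b < inv w c"
    moreover have "inv w b \<noteq> inv w c"
      using w abc by (metis less_irrefl)
    ultimately have less: "inv w c < inv w b"
      by simp
    have "1 \<le> inv w c"
      using img[of c] abc by simp
    then obtain s where s: "1 \<le> s" "s \<le> inv w c" "run_start w s" "c \<le> w s"
      using run_start_below[of "inv w c" w] w[of c] by auto
    have "inv w b \<le> n"
      using img[of b] abc by simp
    then have "w s < w (inv w b)"
      using assms(2) s less start unfolding fireworks_def by (meson le_less_trans)
    then show False
      using w[of b] s(4) abc by simp
  qed
qed

theorem theorem3p15:
  fixes n :: nat and w :: "nat \<Rightarrow> nat" and \<alpha> :: mono
  assumes "w permutes {1..n}"
    and "fireworks n w"
    and "\<alpha> \<in> supp (groth n w)"
    and "absv \<alpha> < tdeg (groth n w)"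
  shows "\<exists>\<beta>\<in>supp (groth n w). comp_less \<alpha> \<beta>"
proof -
  have "\<exists>\<beta>\<in>supp (groth n w). \<forall>\<gamma>\<in>supp (groth n w). comp_le \<gamma> \<beta>"
  proof (cases "n = 0")
    \<comment> \<open>For \<open>n = 0\<close> the interval \<open>{1..1 + (n - 1)}\<close> is not
      \<open>{1..n}\<close>, so the polynomial is computed directly.\<close>
    case True
    then have "ninv n w = 0"
      by (simp add: ninv_eq_0_iff)
    then have "groth n w = 1"
      using True by (simp add: groth_def top_poly_def)
    then show ?thesis
      by (simp add: supp_def comp_le_def)
  next
    case False
    then have n: "1 + (n - 1) = n"
      by simp
    show ?thesis
      unfolding groth_eq_Phi[OF assms(1)]
      using supp_Phi_greatest[of "inv w" 1 "n - 1"] permutes_inv[OF assms(1)] fireworks_imp_inv_fireworks[OF assms(1,2)]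
      unfolding n by blast
  qed
  then obtain \<beta> where \<beta>: "\<beta> \<in> supp (groth n w)" "\<And>\<gamma>. \<gamma> \<in> supp (groth n w) \<Longrightarrow> comp_le \<gamma> \<beta>"
    by blast
  \<comment> \<open>The componentwise greatest exponent vector has maximal degree, so a vector of
    smaller degree differs from it.\<close>
  have "tdeg (groth n w) \<le> absv \<beta>"
    unfolding tdeg_def using \<beta> by (subst Max_le_iff) (auto simp: supp_def absv_mono)
  then have "\<alpha> \<noteq> \<beta>"
    using assms(4) by auto
  then show ?thesis
    using \<beta> assms(3) by (auto simp: comp_less_def)
qed

end
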